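(* Let $f$ be a non-negative bounded function on $\mathbb{N}$ and let $\Phi$ be a Følner sequence on $\mathbb{N}$ such that $\langle 1,f\rangle_\Phi$ exists. For every $\epsilon>0$ there exist a subsequence $\Psi$ of $\Phi$ and a non-principal ultrafilter $\mathfrak{p}$ on $\mathbb{N}$ such that $\langle \mathsf{R}^m f,\mathsf{R}^{\mathfrak{p}} f\rangle_\Psi$ exists for all $m\in\mathbb{N}$ and $$\lim_{m\to\mathfrak{p}}\langle \mathsf{R}^m f,\mathsf{R}^{\mathfrak{p}} f\rangle_\Psi\ \ge\ \langle 1,f\rangle_\Psi^2-\epsilon.$$
   Context: A Følner sequence in $\mathbb{N}$ is a sequence $\Phi\colon N\mapsto\Phi_N$ of finite non-empty subsets of $\mathbb{N}$ with $|(\Phi_N+m)\triangle\Phi_N|/|\Phi_N|\to0$ for all $m\in\mathbb{N}$. For $f,h\colon\mathbb{N}\to\mathbb{C}$, $\langle f,h\rangle_\Phi=\lim_{N\to\infty}\frac{1}{|\Phi_N|}\sum_{n\in\Phi_N}f(n)\overline{h(n)}$ whenever this limit exists. For bounded $f$ and $m\in\mathbb{N}$, $(\mathsf{R}^m f)(n)=f(n+m)$; for an ultrafilter $\mathfrak{p}$ on $\mathbb{N}$, $(\mathsf{R}^{\mathfrak{p}}f)(n)=\lim_{m\to\mathfrak{p}}f(n+m)$, where $\lim_{m\to\mathfrak{p}}$ denotes the ultrafilter limit of a bounded sequence. *)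

theory Defs
  imports "HOL-Analysis.Analysis"
begin

definition is_ultrafilter :: "nat filter \<Rightarrow> bool" where
  "is_ultrafilter F \<longleftrightarrow> F \<noteq> bot \<and>
     (\<forall>P. eventually P F \<or> eventually (\<lambda>x. \<not> P x) F)"

definition nonprincipal :: "nat filter \<Rightarrow> bool" where
  "nonprincipal F \<longleftrightarrow> (\<forall>n. \<not> eventually (\<lambda>x. x = n) F)"

definition ulim :: "nat filter \<Rightarrow> (nat \<Rightarrow> real) \<Rightarrow> real" where
  "ulim F g = Lim F g"

definition shiftR :: "nat \<Rightarrow> (nat \<Rightarrow> real) \<Rightarrow> nat \<Rightarrow> real" where
  "shiftR m f n = f (n + m)"

definition shiftU :: "nat filter \<Rightarrow> (nat \<Rightarrow> real) \<Rightarrow> nat \<Rightarrow> real" where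
  "shiftU p f n = ulim p (\<lambda>m. f (n + m))"

definition folner :: "(nat \<Rightarrow> nat set) \<Rightarrow> bool" where
  "folner \<Phi> \<longleftrightarrow> (\<forall>N. finite (\<Phi> N) \<and> \<Phi> N \<noteq> {}) \<and>
     (\<forall>m. (\<lambda>N. real (card (((\<lambda>n. n + m) ` \<Phi> N - \<Phi> N) \<union> (\<Phi> N - (\<lambda>n. n + m) ` \<Phi> N)))
               / real (card (\<Phi> N))) \<longlonglongrightarrow> 0)"

text \<open>Finite averages (1/|Phi_N|) sum_{n in Phi_N} f(n) h(n) (real-valued, so no conjugation).\<close>
definition avg_prod :: "(nat \<Rightarrow> nat set) \<Rightarrow> (nat \<Rightarrow> real) \<Rightarrow> (nat \<Rightarrow> real) \<Rightarrow> nat \<Rightarrow> real" where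
  "avg_prod \<Phi> f h N = (\<Sum>n\<in>\<Phi> N. f n * h n) / real (card (\<Phi> N))"

definition corr_exists :: "(nat \<Rightarrow> nat set) \<Rightarrow> (nat \<Rightarrow> real) \<Rightarrow> (nat \<Rightarrow> real) \<Rightarrow> bool" where
  "corr_exists \<Phi> f h \<longleftrightarrow> convergent (avg_prod \<Phi> f h)"

definition corr :: "(nat \<Rightarrow> nat set) \<Rightarrow> (nat \<Rightarrow> real) \<Rightarrow> (nat \<Rightarrow> real) \<Rightarrow> real" where
  "corr \<Phi> f h = lim (avg_prod \<Phi> f h)"

end

theory Submission
  imports Defs "HOL-Probability.Helly_Selection"
begin

text \<open>
Let \<open>\<gamma>(j)\<close> be the correlation of \<open>f\<close> with its shift by \<open>j\<close> along (a subsequence of) \<open>\<Phi>\<close>. By Herglotz and Wiener,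
\<open>\<gamma>\<close> is, outside a set of density zero, uniformly close to a trigonometric polynomial with finitely many
frequencies \<open>\<Theta>\<close>. Hence all shifts \<open>R\<^sup>m f\<close> with generic \<open>m\<close> in a small Bohr set \<open>D\<close> over \<open>\<Theta>\<close> have
nearly constant mutual inner products, and by Bessel's argument they are weakly indistinguishable from one
fixed average \<open>w\<close> of such shifts. It remains to find an ultrafilter \<open>p\<close> of generic points of \<open>D\<close> for which
the average of \<open>w \<cdot> R\<^sup>p f\<close> is at least \<open>d\<^sup>2 - \<epsilon>\<close>, where \<open>d\<close> is the mean of \<open>f\<close>. Weighting \<open>k\<close> by a
positive definite trigonometric polynomial concentrated on \<open>D\<close>, the average of \<open>w(n) f(n + k)\<close> over \<open>n\<close> and \<open>k\<close>
is at least about \<open>d\<^sup>2\<close>, so for infinitely many \<open>N\<close> the set of \<open>k \<in> D\<close> where the average over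
\<open>n \<in> \<Phi>\<^sub>N\<close> is large has density bounded below. Bergelson's intersectivity lemma then yields an ultrafilter that
contains infinitely many of these sets.
\<close>

subsection \<open>Ultrafilter limits\<close>

text \<open>The obstacle is a circular dependence: \<open>shiftU p f\<close> must be known before a
  subsequence can be chosen along which its correlations converge, while \<open>p\<close> has to be
  adapted to the averages along that subsequence. Moreover a limit along \<open>p\<close> passes
  through a single finite average over \<open>\<Phi> N\<close>, but not in general through a limit
  of such averages. The sets fed into intersectivity are therefore attached to individual indices
  \<open>N\<close>. The exchange of limits is made at each \<open>N\<close> whose set lies in
  \<open>p\<close>, and only afterwards is a second ultrafilter taken on these indices, and from it
  the subsequence. The two stages use different invariant means; they agree on the correlations of
  shifts of \<open>f\<close> because these are first made to converge along the whole sequence.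
  Positive definiteness of the weight protects the lower bound \<open>d\<^sup>2\<close>: nonzero
  frequencies contribute nonnegative amounts, and frequency zero contributes exactly its share of
  \<open>d\<^sup>2\<close>.\<close>

lemma ultrafilter_below:
  fixes F :: "nat filter"
  assumes "F \<noteq> bot"
  obtains p where "p \<le> F" "is_ultrafilter p"
proof -
  let ?A = "{G. G \<noteq> bot \<and> G \<le> F}"
  have "\<exists>m\<in>?A. \<forall>a\<in>?A. a \<le> m \<longrightarrow> a = m"
  \<comment> \<open>The order is reversed, so that the maximal element found is a minimal filter
    among those other than \<open>bot\<close>.\<close>
  proof (rule predicate_Zorn[where P = "\<lambda>x y. y \<le> x"])
    show "partial_order_on ?A (relation_of (\<lambda>x y. y \<le> x) ?A)"
      by (auto simp: partial_order_on_def preorder_on_def refl_on_def trans_def antisym_def relation_of_def)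
    fix C assume C: "C \<in> Chains (relation_of (\<lambda>x y. y \<le> x) ?A)"
    show "\<exists>u\<in>?A. \<forall>a\<in>C. u \<le> a"
    proof (cases "C = {}")
      case True
      then show ?thesis using assms by auto
    next
      case False
      have sub: "C \<subseteq> ?A" and tot: "\<And>a b. a \<in> C \<Longrightarrow> b \<in> C \<Longrightarrow> a \<le> b \<or> b \<le> a"
        using C by (auto simp: Chains_def relation_of_def)
      \<comment> \<open>A chain is a filter base, so a property holds eventually in the infimum only
        if it does so in some member.\<close>
      have "Inf C \<noteq> bot"
        unfolding trivial_limit_def
      proof (subst eventually_Inf_base[OF False])
        show "\<exists>x\<in>C. x \<le> inf a b" if "a \<in> C" "b \<in> C" for a b
          using tot[OF that] that by (auto intro: bexI[of _ a] bexI[of _ b])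
        show "\<not> (\<exists>b\<in>C. eventually (\<lambda>x. False) b)"
          using sub by (auto simp: trivial_limit_def)
      qed
      moreover obtain c where "c \<in> C" using False by blast
      then have "Inf C \<le> F" using sub by (intro Inf_lower2[of c]) auto
      ultimately show ?thesis by (intro bexI[of _ "Inf C"]) (auto intro: Inf_lower)
    qed
  qed
  then obtain m where m: "m \<noteq> bot" "m \<le> F" and max: "\<And>a. a \<noteq> bot \<Longrightarrow> a \<le> m \<Longrightarrow> a = m"
    by (auto intro: order_trans)
  have "eventually P m \<or> eventually (\<lambda>x. \<not> P x) m" for P
  proof (rule disjCI)
    assume "\<not> eventually (\<lambda>x. \<not> P x) m"
    then have "inf m (principal {x. P x}) \<noteq> bot"
      by (simp add: trivial_limit_def eventually_inf_principal)
    then have "inf m (principal {x. P x}) = m" by (intro max) auto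
    moreover have "eventually P (inf m (principal {x. P x}))"
      by (simp add: eventually_inf_principal)
    ultimately show "eventually P m" by simp
  qed
  with m that show thesis by (auto simp: is_ultrafilter_def)
qed

lemma ultrafilter_not_bot: "is_ultrafilter p \<Longrightarrow> p \<noteq> bot"
  by (simp add: is_ultrafilter_def)

text \<open>Boundedness puts the image filter on a compact interval, which gives a cluster point;
  since an ultrafilter decides every neighbourhood, the cluster point is a limit. Thus
  \<open>ulim\<close>, a bare \<open>Lim\<close>, is an actual limit for bounded sequences.\<close>

lemma ultrafilter_tendsto:
  fixes h :: "nat \<Rightarrow> real"
  assumes p: "is_ultrafilter p" and b: "bounded (range h)"
  shows "(h \<longlongrightarrow> ulim p h) p"
proof -
  obtain C where C: "\<And>n. \<bar>h n\<bar> \<le> C" using b by (auto simp: bounded_iff)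
  have "filtermap h p \<noteq> bot" using p by (simp add: filtermap_bot_iff is_ultrafilter_def)
  moreover have "eventually (\<lambda>x. x \<in> {-C..C}) (filtermap h p)"
    using C by (auto simp: eventually_filtermap abs_le_iff minus_le_iff intro!: always_eventually)
  ultimately obtain x where x: "inf (nhds x) (filtermap h p) \<noteq> bot"
    using compact_Icc[of "-C" C] unfolding compact_filter by blast
  have "(h \<longlongrightarrow> x) p"
  proof (rule topological_tendstoI)
    fix S assume "open S" "x \<in> S"
    then have S: "eventually (\<lambda>y. y \<in> S) (nhds x)" by (rule eventually_nhds_in_open)
    show "eventually (\<lambda>n. h n \<in> S) p"
    proof (rule ccontr)
      assume "\<not> eventually (\<lambda>n. h n \<in> S) p"
      then have "eventually (\<lambda>n. h n \<notin> S) p" using p by (auto simp: is_ultrafilter_def)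
      then have "eventually (\<lambda>y. y \<notin> S) (filtermap h p)" by (simp add: eventually_filtermap)
      with S have "eventually (\<lambda>y. False) (inf (nhds x) (filtermap h p))"
        unfolding eventually_inf by blast
      with x show False by (simp add: trivial_limit_def)
    qed
  qed
  moreover have "ulim p h = x"
    unfolding ulim_def using p calculation by (intro tendsto_Lim) (auto simp: is_ultrafilter_def)
  ultimately show ?thesis by simp
qed

lemma ulim_eq:
  assumes "is_ultrafilter p" "(h \<longlongrightarrow> x) p"
  shows "ulim p h = x"
  using assms unfolding ulim_def is_ultrafilter_def by (intro tendsto_Lim) auto

lemma nonprincipal_le_sequentially:
  assumes "is_ultrafilter p"
  shows "nonprincipal p \<longleftrightarrow> p \<le> sequentially"
proof
  assume np: "nonprincipal p"
  have "eventually (\<lambda>n. n \<noteq> k) p" for k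
    using assms np unfolding is_ultrafilter_def nonprincipal_def by blast
  then have *: "eventually (\<lambda>n. \<forall>k\<in>{..<N}. n \<noteq> k) p" for N
    by (simp add: eventually_ball_finite_distrib)
  have "eventually (\<lambda>n. N \<le> n) p" for N
    using *[of N] by (rule eventually_mono) (metis lessThan_iff linorder_not_le)
  then show "p \<le> sequentially"
    unfolding le_filter_def eventually_sequentially by (metis (mono_tags, lifting) eventually_mono)
next
  assume le: "p \<le> sequentially"
  show "nonprincipal p"
    unfolding nonprincipal_def
  proof (intro allI notI)
    fix n assume "eventually (\<lambda>x. x = n) p"
    moreover have "eventually (\<lambda>x. n < x) p"
      using le by (metis eventually_gt_at_top filter_leD)
    ultimately have "eventually (\<lambda>x. False) p" by eventually_elim auto
    with assms show False by (simp add: is_ultrafilter_def)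
  qed
qed

text \<open>Diagonal choice: the index \<open>r k\<close> serves \<open>h 0\<close> to
  \<open>h k\<close> at once with error below \<open>1 / Suc k\<close>. One subsequence thus
  realises the ultrafilter limits of countably many bounded sequences.\<close>

lemma subsequence_of_ultrafilter:
  fixes h :: "nat \<Rightarrow> nat \<Rightarrow> real"
  assumes U: "is_ultrafilter U" "U \<le> sequentially" and I: "eventually (\<lambda>n. n \<in> I) U"
    and b: "\<And>i. bounded (range (h i))"
  obtains r where "strict_mono r" "\<And>k. r k \<in> I" "\<And>i. (\<lambda>k. h i (r k)) \<longlonglongrightarrow> ulim U (h i)"
proof -
  define Q where "Q k n \<longleftrightarrow> n \<in> I \<and> (\<forall>i\<le>k. dist (h i n) (ulim U (h i)) < 1 / real (Suc k))" for k n
  have Q: "eventually (Q k) U" for k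
  proof -
    have "eventually (\<lambda>n. \<forall>i\<in>{..k}. dist (h i n) (ulim U (h i)) < 1 / real (Suc k)) U"
      by (intro eventually_ball_finite ballI tendstoD[OF ultrafilter_tendsto[OF U(1) b]]) auto
    with I show ?thesis unfolding Q_def by eventually_elim auto
  qed
  have "\<exists>r. \<forall>k. Q k (r k) \<and> r k < r (Suc k)"
  proof (rule dependent_nat_choice)
    show "\<exists>x. Q 0 x" using Q[of 0] U(1) eventually_happens' unfolding is_ultrafilter_def by blast
    fix x k
    have "eventually (\<lambda>y. x < y) U" using U(2) by (metis eventually_gt_at_top filter_leD)
    with Q[of "Suc k"] have "eventually (\<lambda>y. Q (Suc k) y \<and> x < y) U" by (rule eventually_conj)
    then show "\<exists>y. Q (Suc k) y \<and> x < y"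
      using U(1) eventually_happens' unfolding is_ultrafilter_def by blast
  qed
  then obtain r where r: "\<And>k. Q k (r k)" "\<And>k. r k < r (Suc k)" by blast
  have "(\<lambda>k. h i (r k)) \<longlonglongrightarrow> ulim U (h i)" for i
  proof (rule metric_tendsto_imp_tendsto[OF LIMSEQ_inverse_real_of_nat])
    show "\<forall>\<^sub>F k in sequentially. dist (h i (r k)) (ulim U (h i)) \<le> dist (inverse (real (Suc k))) 0"
      using eventually_ge_at_top[of i]
    proof eventually_elim
      case (elim k)
      then have "dist (h i (r k)) (ulim U (h i)) < 1 / real (Suc k)" using r(1)[of k] by (simp add: Q_def)
      then show ?case by (simp add: divide_inverse dist_real_def)
    qed
  qed
  with r that[of r] show thesis by (auto simp: Q_def strict_mono_Suc_iff)
qed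

subsection \<open>Averages and invariant means\<close>

text \<open>A separate name gives the closure rules below a target, so that the boundedness
  conditions of invariant means are discharged by introduction rules.\<close>

definition bdd :: "(nat \<Rightarrow> real) \<Rightarrow> bool" where
  "bdd h \<longleftrightarrow> bounded (range h)"

lemma bddI: "(\<And>n. \<bar>h n\<bar> \<le> C) \<Longrightarrow> bdd h"
  by (auto simp: bdd_def bounded_iff)

lemma bddE: assumes "bdd h" obtains C where "C > 0" "\<And>n. \<bar>h n\<bar> \<le> C"
  using assms unfolding bdd_def bounded_pos by auto

lemma bdd_const [simp, intro]: "bdd (\<lambda>n. c)"
  by (rule bddI[of _ "\<bar>c\<bar>"]) auto

lemma bdd_add [intro!]: assumes "bdd g" "bdd h" shows "bdd (\<lambda>n. g n + h n)"
proof -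
  obtain C where C: "\<And>n. \<bar>g n\<bar> \<le> C" using bddE[OF assms(1)] by blast
  obtain B where B: "\<And>n. \<bar>h n\<bar> \<le> B" using bddE[OF assms(2)] by blast
  show ?thesis by (rule bddI[of _ "C + B"]) (rule order_trans[OF abs_triangle_ineq add_mono[OF C B]])
qed

lemma bdd_mult [intro!]: assumes "bdd g" "bdd h" shows "bdd (\<lambda>n. g n * h n)"
proof -
  obtain C where C: "C > 0" "\<And>n. \<bar>g n\<bar> \<le> C" using bddE[OF assms(1)] by blast
  obtain B where B: "B > 0" "\<And>n. \<bar>h n\<bar> \<le> B" using bddE[OF assms(2)] by blast
  show ?thesis by (rule bddI[of _ "C * B"]) (use C B in \<open>auto simp: abs_mult intro!: mult_mono\<close>)
qed

lemma bdd_uminus [intro!]: "bdd g \<Longrightarrow> bdd (\<lambda>n. - g n)"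
  by (auto simp: bdd_def bounded_iff)

lemma bdd_abs [intro!]: "bdd g \<Longrightarrow> bdd (\<lambda>n. \<bar>g n\<bar>)"
  by (auto simp: bdd_def bounded_iff)

lemma bdd_diff [intro!]: "bdd g \<Longrightarrow> bdd h \<Longrightarrow> bdd (\<lambda>n. g n - h n)"
  using bdd_add[of g "\<lambda>n. - h n"] by auto

lemma bdd_divide [intro!]: "bdd g \<Longrightarrow> bdd (\<lambda>n. g n / c)"
  unfolding divide_inverse by (rule bdd_mult) auto

lemma bdd_power [intro!]: "bdd g \<Longrightarrow> bdd (\<lambda>n. g n ^ k)"
  by (induction k) auto

lemma bdd_sum [intro!]: "(\<And>i. i \<in> I \<Longrightarrow> bdd (g i)) \<Longrightarrow> bdd (\<lambda>n. \<Sum>i\<in>I. g i n)"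
  by (induction I rule: infinite_finite_induct) auto

lemma bdd_shift [intro]: "bdd g \<Longrightarrow> bdd (\<lambda>n. g (n + m))"
  by (auto simp: bdd_def bounded_iff)

lemma bdd_cos [intro, simp]: "bdd (\<lambda>n. cos (k n))"
  by (rule bddI[of _ 1]) auto

lemma bdd_sin [intro, simp]: "bdd (\<lambda>n. sin (k n))"
  by (rule bddI[of _ 1]) auto

lemma bdd_indicator [intro, simp]: "bdd (indicator A)"
  by (rule bddI[of _ 1]) (auto simp: indicator_def)

definition favg :: "nat set \<Rightarrow> (nat \<Rightarrow> real) \<Rightarrow> real" where
  "favg A h = (\<Sum>n\<in>A. h n) / real (card A)"

lemma avg_prod_eq_favg: "avg_prod \<Phi> f h N = favg (\<Phi> N) (\<lambda>n. f n * h n)"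
  by (simp add: avg_prod_def favg_def)

lemma favg_add: "favg A (\<lambda>n. g n + h n) = favg A g + favg A h"
  by (simp add: favg_def sum.distrib add_divide_distrib)

lemma favg_diff: "favg A (\<lambda>n. g n - h n) = favg A g - favg A h"
  by (simp add: favg_def sum_subtractf diff_divide_distrib)

lemma favg_cmult: "favg A (\<lambda>n. c * h n) = c * favg A h"
  by (simp add: favg_def sum_distrib_left)

lemma favg_mono: "(\<And>n. g n \<le> h n) \<Longrightarrow> favg A g \<le> favg A h"
  by (auto simp: favg_def intro!: divide_right_mono sum_mono)

lemma favg_const: "finite A \<Longrightarrow> A \<noteq> {} \<Longrightarrow> favg A (\<lambda>_. c) = c"
  by (simp add: favg_def)

lemma favg_abs_le:
  assumes "\<And>n. \<bar>h n\<bar> \<le> C"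
  shows "\<bar>favg A h\<bar> \<le> C"
proof -
  have C: "0 \<le> C" using assms[of 0] by linarith
  have "\<bar>\<Sum>n\<in>A. h n\<bar> \<le> real (card A) * C"
    by (rule order_trans[OF sum_abs sum_bounded_above]) (use assms in auto)
  \<comment> \<open>For empty or infinite \<open>A\<close> the cardinality is 0 and the quotient is
    0 by convention.\<close>
  then show ?thesis using C by (cases "card A = 0") (auto simp: favg_def field_simps)
qed

lemma bdd_favg: "bdd h \<Longrightarrow> bdd (\<lambda>N. favg (\<Phi> N) h)"
  by (elim bddE) (auto intro!: bddI favg_abs_le)

text \<open>The two sums cancel on the common part of \<open>\<Phi> N\<close> and its translate, and
  the symmetric difference has negligible relative size.\<close>

lemma folner_favg_shift:
  assumes fol: "folner \<Phi>" and h: "bdd h"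
  shows "(\<lambda>N. favg (\<Phi> N) (\<lambda>n. h (n + m)) - favg (\<Phi> N) h) \<longlonglongrightarrow> 0"
proof -
  obtain C where C: "C > 0" "\<And>n. \<bar>h n\<bar> \<le> C" using bddE[OF h] by blast
  let ?S = "\<lambda>N. (\<lambda>n. n + m) ` \<Phi> N"
  let ?D = "\<lambda>N. (?S N - \<Phi> N) \<union> (\<Phi> N - ?S N)"
  have lim: "(\<lambda>N. C * (real (card (?D N)) / real (card (\<Phi> N)))) \<longlonglongrightarrow> C * 0"
    using fol unfolding folner_def by (intro tendsto_mult tendsto_const) auto
  have fin: "finite (\<Phi> N)" for N using fol by (auto simp: folner_def)
  show ?thesis
  proof (rule Lim_null_comparison[OF always_eventually])
    show "(\<lambda>N. C * (real (card (?D N)) / real (card (\<Phi> N)))) \<longlonglongrightarrow> 0" using lim by simp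
    show "\<forall>N. norm (favg (\<Phi> N) (\<lambda>n. h (n + m)) - favg (\<Phi> N) h)
             \<le> C * (real (card (?D N)) / real (card (\<Phi> N)))"
    proof
      fix N
      have "(\<Sum>n\<in>\<Phi> N. h (n + m)) = (\<Sum>n\<in>?S N. h n)"
        by (subst sum.reindex) (auto simp: inj_on_def)
      also have "\<dots> = (\<Sum>n\<in>?S N - \<Phi> N. h n) + (\<Sum>n\<in>?S N \<inter> \<Phi> N. h n)"
        using fin by (subst sum.union_disjoint[symmetric]) (auto intro!: sum.cong)
      finally have 1: "(\<Sum>n\<in>\<Phi> N. h (n + m)) = (\<Sum>n\<in>?S N - \<Phi> N. h n) + (\<Sum>n\<in>?S N \<inter> \<Phi> N. h n)" .
      have 2: "(\<Sum>n\<in>\<Phi> N. h n) = (\<Sum>n\<in>\<Phi> N - ?S N. h n) + (\<Sum>n\<in>?S N \<inter> \<Phi> N. h n)"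
        using fin by (subst sum.union_disjoint[symmetric]) (auto intro!: sum.cong)
      have "\<bar>(\<Sum>n\<in>\<Phi> N. h (n + m)) - (\<Sum>n\<in>\<Phi> N. h n)\<bar> \<le> (\<Sum>n\<in>?S N - \<Phi> N. \<bar>h n\<bar>) + (\<Sum>n\<in>\<Phi> N - ?S N. \<bar>h n\<bar>)"
        unfolding 1 2 using sum_abs[of h "?S N - \<Phi> N"] sum_abs[of h "\<Phi> N - ?S N"] by linarith
      also have "\<dots> = (\<Sum>n\<in>?D N. \<bar>h n\<bar>)"
        using fin by (subst sum.union_disjoint) auto
      also have "\<dots> \<le> real (card (?D N)) * C"
        by (rule sum_bounded_above) (use C in auto)
      finally show "norm (favg (\<Phi> N) (\<lambda>n. h (n + m)) - favg (\<Phi> N) h)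
             \<le> C * (real (card (?D N)) / real (card (\<Phi> N)))"
        by (simp add: favg_def diff_divide_distrib[symmetric] abs_divide divide_right_mono mult.commute)
    qed
  qed
qed

lemma folner_subseq: "folner \<Phi> \<Longrightarrow> strict_mono r \<Longrightarrow> folner (\<Phi> \<circ> r)"
  unfolding folner_def using LIMSEQ_subseq_LIMSEQ[of _ _ r] by (fastforce simp: comp_def)

text \<open>The half-integer offset writes a cosine sequence, up to the factor
  \<open>2 * sin (x / 2)\<close>, as the difference between a bounded sequence and its shift.
  Averages that ignore shifts must annihilate it unless the factor vanishes.\<close>

lemma cos_telescope: "2 * sin (x / 2) * cos (real n * x) = sin ((real (n + 1) - 1/2) * x) - sin ((real n - 1/2) * x)"
proof -
  have "(real (n + 1) - 1/2) * x = real n * x + x / 2" "(real n - 1/2) * x = real n * x - x / 2"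
    by (simp_all add: algebra_simps)
  then show ?thesis by (simp only: sin_add sin_diff) (simp add: algebra_simps)
qed

lemma folner_favg_cos:
  assumes "folner \<Phi>" "sin (x / 2) \<noteq> 0"
  shows "(\<lambda>N. favg (\<Phi> N) (\<lambda>n. cos (real n * x))) \<longlonglongrightarrow> 0"
proof -
  let ?h = "\<lambda>n. sin ((real n - 1/2) * x)"
  have "(\<lambda>N. (favg (\<Phi> N) (\<lambda>n. ?h (n + 1)) - favg (\<Phi> N) ?h) / (2 * sin (x / 2))) \<longlonglongrightarrow> 0 / (2 * sin (x / 2))"
    using assms by (intro tendsto_divide folner_favg_shift[OF assms(1)]) auto
  also have "(\<lambda>N. (favg (\<Phi> N) (\<lambda>n. ?h (n + 1)) - favg (\<Phi> N) ?h) / (2 * sin (x / 2)))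
     = (\<lambda>N. favg (\<Phi> N) (\<lambda>n. cos (real n * x)))"
    unfolding favg_diff[symmetric] cos_telescope[symmetric] favg_cmult using assms by simp
  finally show ?thesis by simp
qed

text \<open>Only finite additivity on bounded functions is assumed, so exchanges are limited to
  finite sums. The abstraction lets the same estimates serve the mean used to find the ultrafilter
  and the later one used to choose the subsequence.\<close>

locale invariant_mean =
  fixes \<Lambda> :: "(nat \<Rightarrow> real) \<Rightarrow> real"
  assumes add: "bdd g \<Longrightarrow> bdd h \<Longrightarrow> \<Lambda> (\<lambda>n. g n + h n) = \<Lambda> g + \<Lambda> h"
    and cmult: "bdd g \<Longrightarrow> \<Lambda> (\<lambda>n. c * g n) = c * \<Lambda> g"
    and mono: "bdd g \<Longrightarrow> bdd h \<Longrightarrow> (\<And>n. g n \<le> h n) \<Longrightarrow> \<Lambda> g \<le> \<Lambda> h"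
    and one: "\<Lambda> (\<lambda>_. 1) = 1"
    and shift: "bdd g \<Longrightarrow> \<Lambda> (\<lambda>n. g (n + m)) = \<Lambda> g"
begin

lemma const [simp]: "\<Lambda> (\<lambda>_. c) = c"
  using cmult[of "\<lambda>_. 1" c] one by simp

lemma cmult_right: "bdd g \<Longrightarrow> \<Lambda> (\<lambda>n. g n * c) = \<Lambda> g * c"
  using cmult[of g c] by (simp add: mult.commute)

lemma diff: "bdd g \<Longrightarrow> bdd h \<Longrightarrow> \<Lambda> (\<lambda>n. g n - h n) = \<Lambda> g - \<Lambda> h"
  using add[of g "\<lambda>n. -1 * h n"] cmult[of h "-1"] by (auto simp: bdd_uminus)

lemma sum: "finite I \<Longrightarrow> (\<And>i. i \<in> I \<Longrightarrow> bdd (g i)) \<Longrightarrow> \<Lambda> (\<lambda>n. \<Sum>i\<in>I. g i n) = (\<Sum>i\<in>I. \<Lambda> (g i))"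
  by (induction I rule: finite_induct) (simp_all add: add bdd_sum)

lemma nonneg: "bdd g \<Longrightarrow> (\<And>n. 0 \<le> g n) \<Longrightarrow> 0 \<le> \<Lambda> g"
  using mono[of "\<lambda>_. 0" g] by simp

lemma abs_le: "(\<And>n. \<bar>g n\<bar> \<le> C) \<Longrightarrow> \<bar>\<Lambda> g\<bar> \<le> C"
  using mono[of g "\<lambda>_. C"] mono[of "\<lambda>_. - C" g] bddI[of g C] by (simp add: abs_le_iff) (smt (verit))

text \<open>Nonnegativity of the variance; it stands in for the Cauchy-Schwarz inequality.\<close>

lemma square_le:
  assumes "bdd g" shows "(\<Lambda> g)\<^sup>2 \<le> \<Lambda> (\<lambda>n. (g n)\<^sup>2)"
proof -
  have "0 \<le> \<Lambda> (\<lambda>n. (g n - \<Lambda> g)\<^sup>2)" using assms by (intro nonneg) auto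
  also have "(\<lambda>n. (g n - \<Lambda> g)\<^sup>2) = (\<lambda>n. (g n)\<^sup>2 - ((2 * \<Lambda> g) * g n - (\<Lambda> g)\<^sup>2))"
    by (simp add: power2_eq_square algebra_simps)
  also have "\<Lambda> \<dots> = \<Lambda> (\<lambda>n. (g n)\<^sup>2) - (2 * \<Lambda> g * \<Lambda> g - (\<Lambda> g)\<^sup>2)"
    using assms by (subst diff diff cmult; auto)+
  finally show ?thesis by (simp add: power2_eq_square)
qed

lemma cos_zero:
  assumes "sin (x / 2) \<noteq> 0"
  shows "\<Lambda> (\<lambda>n. cos (real n * x)) = 0"
proof -
  have "2 * sin (x / 2) * \<Lambda> (\<lambda>n. cos (real n * x))
      = \<Lambda> (\<lambda>n. sin ((real (n + 1) - 1/2) * x)) - \<Lambda> (\<lambda>n. sin ((real n - 1/2) * x))"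
    by (subst diff[symmetric]) (simp_all only: cos_telescope[symmetric] cmult bdd_cos bdd_sin)
  also have "\<dots> = 0" using shift[of "\<lambda>n. sin ((real n - 1/2) * x)" 1] by simp
  finally show ?thesis using assms by simp
qed

end

text \<open>An ultrafilter limit assigns a mean to every bounded function, including products with
  \<open>shiftU p f\<close>, whose averages need not converge.\<close>

definition folner_mean :: "nat filter \<Rightarrow> (nat \<Rightarrow> nat set) \<Rightarrow> (nat \<Rightarrow> real) \<Rightarrow> real" where
  "folner_mean U \<Phi> h = ulim U (\<lambda>N. favg (\<Phi> N) h)"

lemma folner_mean_tendsto:
  assumes "is_ultrafilter U" "bdd h"
  shows "((\<lambda>N. favg (\<Phi> N) h) \<longlongrightarrow> folner_mean U \<Phi> h) U"
  unfolding folner_mean_def using bdd_favg[OF assms(2), of \<Phi>]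
  by (intro ultrafilter_tendsto[OF assms(1)]) (simp add: bdd_def)

lemma folner_mean_eqI:
  assumes "is_ultrafilter U" "U \<le> sequentially" "(\<lambda>N. favg (\<Phi> N) h) \<longlonglongrightarrow> x"
  shows "folner_mean U \<Phi> h = x"
  unfolding folner_mean_def using assms by (intro ulim_eq) (auto intro: tendsto_mono)

lemma invariant_mean_folner:
  assumes U: "is_ultrafilter U" "U \<le> sequentially" and fol: "folner \<Phi>"
  shows "invariant_mean (folner_mean U \<Phi>)"
proof
  note lim = folner_mean_tendsto[OF U(1), of _ \<Phi>]
  have nb: "U \<noteq> bot" using U by (simp add: is_ultrafilter_def)
  show "folner_mean U \<Phi> (\<lambda>n. g n + h n) = folner_mean U \<Phi> g + folner_mean U \<Phi> h" if "bdd g" "bdd h" for g h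
    unfolding folner_mean_def[of U \<Phi> "\<lambda>n. g n + h n"] favg_add
    by (intro ulim_eq U tendsto_add lim that)
  show "folner_mean U \<Phi> (\<lambda>n. c * g n) = c * folner_mean U \<Phi> g" if "bdd g" for g c
    unfolding folner_mean_def[of U \<Phi> "\<lambda>n. c * g n"] favg_cmult
    by (intro ulim_eq U tendsto_mult tendsto_const lim that)
  show "folner_mean U \<Phi> g \<le> folner_mean U \<Phi> h" if "bdd g" "bdd h" "\<And>n. g n \<le> h n" for g h
    using favg_mono[of g h] that(3) by (intro tendsto_le[OF nb lim[OF that(2)] lim[OF that(1)]]) simp
  show "folner_mean U \<Phi> (\<lambda>_. 1) = 1"
    using fol by (intro folner_mean_eqI U) (auto simp: favg_const folner_def)
  show "folner_mean U \<Phi> (\<lambda>n. g (n + m)) = folner_mean U \<Phi> g" if "bdd g" for g m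
  proof -
    have "((\<lambda>N. favg (\<Phi> N) (\<lambda>n. g (n + m)) - favg (\<Phi> N) g) \<longlongrightarrow> 0) U"
      using folner_favg_shift[OF fol that] U(2) by (rule tendsto_mono[rotated])
    moreover have "((\<lambda>N. favg (\<Phi> N) (\<lambda>n. g (n + m)) - favg (\<Phi> N) g) \<longlongrightarrow>
       folner_mean U \<Phi> (\<lambda>n. g (n + m)) - folner_mean U \<Phi> g) U"
      using that by (intro tendsto_diff lim) auto
    ultimately show ?thesis using tendsto_unique[OF nb] by fastforce
  qed
qed

subsection \<open>Spectral measures\<close>

lemma has_bochner_integral_cos_int:
  fixes p :: int
  shows "has_bochner_integral lborel (\<lambda>x. cos (of_int p * x) * indicator {0..2*pi} x) (if p = 0 then 2 * pi else 0)"
proof (cases "p = 0")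
  case True
  then show ?thesis
    using has_bochner_integral_FTC_Icc_real[of 0 "2*pi" "\<lambda>x. x" "\<lambda>x. 1"] by simp
next
  case False
  have "has_bochner_integral lborel (\<lambda>x. cos (of_int p * x) * indicator {0..2*pi} x)
      (sin (of_int p * (2*pi)) / of_int p - sin (of_int p * 0) / of_int p)"
    using False by (intro has_bochner_integral_FTC_Icc_real) (auto intro!: derivative_eq_intros)
  moreover have "sin (of_int p * (2*pi)) = 0"
    using sin_int_2pin[of p] by (simp add: mult.commute)
  ultimately show ?thesis using False by simp
qed

text \<open>The hypothesis says that the Fejer sums are nonnegative, so after normalisation they are
  probability densities on a period. Their cosine coefficients are \<open>\<gamma> j\<close> times
  the Fejer weight, which tends to 1, and Helly selection gives a limit measure. Cosines suffice
  because \<open>\<gamma>\<close> is real and extended evenly to the integers.\<close>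

theorem herglotz:
  fixes \<gamma> :: "nat \<Rightarrow> real"
  assumes one: "\<gamma> 0 = 1"
    and pd: "\<And>N x. 0 \<le> (\<Sum>k<N. \<Sum>l<N. \<gamma> (nat \<bar>int k - int l\<bar>) * cos (of_int (int k - int l) * x))"
  obtains M where "real_distribution M" "\<And>j. \<gamma> j = (\<integral>x. cos (real j * x) \<partial>M)"
proof -
  define S where "S n x = (\<Sum>k<Suc n. \<Sum>l<Suc n. \<gamma> (nat \<bar>int k - int l\<bar>) * cos (of_int (int k - int l) * x))" for n x
  define \<rho> where "\<rho> n x = S n x / (2 * pi * real (Suc n)) * indicator {0..2*pi} x" for n x
  define \<mu> where "\<mu> n = density lborel (\<lambda>x. ennreal (\<rho> n x))" for n
  have \<rho>0: "0 \<le> \<rho> n x" for n x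
    unfolding \<rho>_def S_def by (intro mult_nonneg_nonneg divide_nonneg_nonneg pd) auto
  have \<rho>m [measurable]: "\<rho> n \<in> borel_measurable borel" for n
    unfolding \<rho>_def[abs_def] S_def by measurable
  \<comment> \<open>There are \<open>N - j\<close> pairs with \<open>l = k + j\<close>, and
    truncated subtraction correctly gives none for \<open>j \<ge> N\<close>. This is the origin of
    the Fejer weight.\<close>
  have count: "(\<Sum>k<N. \<Sum>l<N. \<gamma> (nat \<bar>int k - int l\<bar>) * (if int k - int l + int j = 0 then 1 else 0)) = real (N - j) * \<gamma> j"
    for N j
  proof -
    have "(\<Sum>k<N. \<Sum>l<N. \<gamma> (nat \<bar>int k - int l\<bar>) * (if int k - int l + int j = 0 then 1 else 0))
      = (\<Sum>k<N. \<Sum>l<N. if l = k + j then \<gamma> j else 0)"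
      by (intro sum.cong refl) auto
    also have "\<dots> = (\<Sum>k<N. if k < N - j then \<gamma> j else 0)"
      by (intro sum.cong refl) (auto simp: sum.delta)
    also have "\<dots> = (\<Sum>k\<in>{..<N - j}. \<gamma> j)"
      by (rule sum.mono_neutral_cong_right) auto
    finally show ?thesis by simp
  qed
  have count': "(\<Sum>k<N. \<Sum>l<N. \<gamma> (nat \<bar>int k - int l\<bar>) * (if int k - int l - int j = 0 then 1 else 0)) = real (N - j) * \<gamma> j"
    for N j
    unfolding count[symmetric]
    by (subst sum.swap) (intro sum.cong refl arg_cong2[where f = "(*)"], auto simp: abs_minus_commute)
  have int: "has_bochner_integral lborel (\<lambda>x. \<rho> n x * cos (real j * x)) (real (Suc n - j) / real (Suc n) * \<gamma> j)" for n j
  proof -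
    let ?c = "1 / (2 * pi * real (Suc n))"
    let ?b = "\<lambda>p::int. if p = 0 then 2 * pi else 0"
    \<comment> \<open>Product-to-sum yields the integer frequencies \<open>k - l + j\<close> and
      \<open>k - l - j\<close>; over a full period only frequency 0 survives.\<close>
    have eq: "\<rho> n x * cos (real j * x) = ?c * (\<Sum>k<Suc n. \<Sum>l<Suc n. \<gamma> (nat \<bar>int k - int l\<bar>) / 2 *
       (cos (of_int (int k - int l + int j) * x) * indicator {0..2*pi} x
        + cos (of_int (int k - int l - int j) * x) * indicator {0..2*pi} x))" for x
      unfolding \<rho>_def S_def sum_divide_distrib sum_distrib_right sum_distrib_left
      by (intro sum.cong refl) (simp add: algebra_simps cos_add cos_diff add_divide_distrib sin_add sin_diff)
    have "has_bochner_integral lborel (\<lambda>x. \<rho> n x * cos (real j * x))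
       (?c * (\<Sum>k<Suc n. \<Sum>l<Suc n. \<gamma> (nat \<bar>int k - int l\<bar>) / 2 * (?b (int k - int l + int j) + ?b (int k - int l - int j))))"
      unfolding eq
      by (intro has_bochner_integral_mult_right has_bochner_integral_sum has_bochner_integral_add
          has_bochner_integral_cos_int)
    also have "(\<Sum>k<Suc n. \<Sum>l<Suc n. \<gamma> (nat \<bar>int k - int l\<bar>) / 2 * (?b (int k - int l + int j) + ?b (int k - int l - int j)))
      = pi * ((\<Sum>k<Suc n. \<Sum>l<Suc n. \<gamma> (nat \<bar>int k - int l\<bar>) * (if int k - int l + int j = 0 then 1 else 0))
        + (\<Sum>k<Suc n. \<Sum>l<Suc n. \<gamma> (nat \<bar>int k - int l\<bar>) * (if int k - int l - int j = 0 then 1 else 0)))"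
      unfolding sum.distrib[symmetric] sum_distrib_left
      by (intro sum.cong refl) auto
    also have "?c * \<dots> = real (Suc n - j) / real (Suc n) * \<gamma> j"
      unfolding count count' by (simp add: divide_simps)
    finally show ?thesis .
  qed
  have dist: "real_distribution (\<mu> n)" for n
  proof -
    have "emeasure (\<mu> n) (space (\<mu> n)) = (\<integral>\<^sup>+ x. ennreal (\<rho> n x) \<partial>lborel)"
      by (simp add: \<mu>_def emeasure_density)
    also have "\<dots> = ennreal 1"
      using int[of n 0] one \<rho>0 by (subst nn_integral_eq_integral) (auto simp: has_bochner_integral_iff)
    finally have "prob_space (\<mu> n)" by (intro prob_spaceI) simp
    then show ?thesis by (simp add: real_distribution_def real_distribution_axioms_def \<mu>_def)
  qed
  have tight: "tight \<mu>"
    unfolding tight_def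
  proof (intro conjI allI impI dist)
    fix e :: real assume e: "e > 0"
    \<comment> \<open>All densities live between 0 and \<open>2 * pi\<close>; the left endpoint is
      -1 because the interval is open there and has to contain 0.\<close>
    have "measure (\<mu> n) {-1<..8} = 1" for n
    proof -
      interpret real_distribution "\<mu> n" by (rule dist)
      have "2 * pi \<le> 8" using pi_less_4 by linarith
      then have "AE x in \<mu> n. x \<in> {-1<..8}"
        unfolding \<mu>_def by (subst AE_density, measurable) (auto intro!: AE_I2 simp: \<rho>_def indicator_def split: if_splits)
      then show ?thesis by (subst prob_eq_1) (auto simp: \<mu>_def)
    qed
    with e show "\<exists>a b. a < b \<and> (\<forall>n. 1 - e < measure (\<mu> n) {a<..b})"
      by (intro exI[of _ "-1"] exI[of _ 8]) auto
  qed
  obtain r M where r: "strict_mono r" and M: "real_distribution M" and conv: "weak_conv_m (\<mu> \<circ> id \<circ> r) M"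
    using tight_imp_convergent_subsubsequence[OF tight, of id] by (auto simp: strict_mono_def)
  have "\<gamma> j = (\<integral>x. cos (real j * x) \<partial>M)" for j
  proof -
    have "(\<lambda>n. \<integral>x. cos (real j * x) \<partial>\<mu> (r n)) \<longlonglongrightarrow> (\<integral>x. cos (real j * x) \<partial>M)"
      using weak_conv_imp_integral_bdd_continuous_conv[of "\<mu> \<circ> id \<circ> r" M "\<lambda>x. cos (real j * x)" 1] dist M conv
      by simp
    moreover have "(\<integral>x. cos (real j * x) \<partial>\<mu> n) = real (Suc n - j) / real (Suc n) * \<gamma> j" for n
      unfolding \<mu>_def using int[of n j] \<rho>0 by (subst integral_density) (auto simp: has_bochner_integral_iff)
    moreover have "(\<lambda>n. real (Suc n - j) / real (Suc n) * \<gamma> j) \<longlonglongrightarrow> 1 * \<gamma> j"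
    proof (intro tendsto_mult tendsto_const)
      have "(\<lambda>n. 1 - real j * inverse (real (Suc n))) \<longlonglongrightarrow> 1 - real j * 0"
        by (intro tendsto_intros LIMSEQ_inverse_real_of_nat)
      then have "(\<lambda>n. 1 - real j * inverse (real (Suc n))) \<longlonglongrightarrow> 1" by simp
      then show "(\<lambda>n. real (Suc n - j) / real (Suc n)) \<longlonglongrightarrow> 1"
        by (rule Lim_transform_eventually)
          (use eventually_ge_at_top[of j] in eventually_elim, auto simp: field_simps of_nat_diff)
    qed
    ultimately have "(\<lambda>n. real (Suc n - j) / real (Suc n) * \<gamma> j) \<longlonglongrightarrow> \<gamma> j"
      and "(\<lambda>n. real (Suc (r n) - j) / real (Suc (r n)) * \<gamma> j) \<longlonglongrightarrow> (\<integral>x. cos (real j * x) \<partial>M)" by auto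
    with LIMSEQ_subseq_LIMSEQ[OF this(1) r] show ?thesis
      by (auto simp: comp_def intro: LIMSEQ_unique)
  qed
  with M that show thesis by blast
qed

text \<open>Wiener's lemma without a product measure: one factor \<open>\<delta> j\<close> is
  expanded as an integral, and dominated convergence is applied twice. For fixed \<open>y\<close>
  the averages of \<open>cos (j * y) * cos (j * x)\<close> tend to 0 unless \<open>x\<close> is
  \<open>y\<close> or \<open>- y\<close> modulo \<open>2 * pi\<close>, and this countable exception
  is null within \<open>A\<close>, which carries no atoms.\<close>

lemma wiener:
  fixes A :: "real set"
  assumes M: "real_distribution M" and fol: "folner \<Phi>"
    and A [measurable]: "A \<in> sets borel" and atomless: "\<And>x. x \<in> A \<Longrightarrow> measure M {x} = 0"
  defines "\<delta> \<equiv> \<lambda>j::nat. \<integral>x. indicator A x * cos (real j * x) \<partial>M"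
  shows "(\<lambda>N. favg (\<Phi> N) (\<lambda>j. (\<delta> j)\<^sup>2)) \<longlonglongrightarrow> 0"
proof -
  interpret real_distribution M by (rule M)
  have [measurable_cong]: "sets M = sets borel" by simp
  have ind: "integrable M (\<lambda>x. indicator A x * cos (real j * x))" for j
    by (rule integrable_const_bound[where B = 1]) (auto simp: indicator_def)
  have favg_int: "favg (\<Phi> N) (\<lambda>j. c j * \<delta> j) = (\<integral>x. indicator A x * favg (\<Phi> N) (\<lambda>j. c j * cos (real j * x)) \<partial>M)" for c N
  proof -
    have "favg (\<Phi> N) (\<lambda>j. c j * \<delta> j) = (\<Sum>j\<in>\<Phi> N. \<integral>x. (c j / real (card (\<Phi> N))) * (indicator A x * cos (real j * x)) \<partial>M)"
      by (simp add: favg_def \<delta>_def sum_divide_distrib)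
    also have "\<dots> = (\<integral>x. (\<Sum>j\<in>\<Phi> N. (c j / real (card (\<Phi> N))) * (indicator A x * cos (real j * x))) \<partial>M)"
      by (subst Bochner_Integration.integral_sum) (auto intro!: ind integrable_mult_right)
    also have "\<dots> = (\<integral>x. indicator A x * favg (\<Phi> N) (\<lambda>j. c j * cos (real j * x)) \<partial>M)"
      by (intro Bochner_Integration.integral_cong refl) (simp add: favg_def sum_divide_distrib sum_distrib_left mult_ac)
    finally show ?thesis .
  qed
  have fm: "(\<lambda>x. indicator A x * favg (\<Phi> N) (\<lambda>j. c j * cos (real j * x))) \<in> borel_measurable M" for c N
    unfolding favg_def by measurable
  have inner: "(\<lambda>N. favg (\<Phi> N) (\<lambda>j. cos (real j * y) * \<delta> j)) \<longlonglongrightarrow> 0" for y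
  proof -
    define Z where "Z = (\<Union>k::int. {2 * pi * of_int k - y, y - 2 * pi * of_int k})"
    have "countable Z" unfolding Z_def by auto
    then have "countable (A \<inter> Z)" by auto
    then have "AE x in M. x \<notin> A \<inter> Z"
      using null_sets_UN'[of "A \<inter> Z" "\<lambda>x. {x}" M] atomless
      by (intro AE_not_in) (auto simp: null_sets_def emeasure_eq_measure)
    then have "(\<lambda>N. \<integral>x. indicator A x * favg (\<Phi> N) (\<lambda>j. cos (real j * y) * cos (real j * x)) \<partial>M) \<longlonglongrightarrow> (\<integral>x. 0 \<partial>M)"
    proof (intro integral_dominated_convergence[where w = "\<lambda>_. 1"])
      show "AE x in M. (\<lambda>N. indicator A x * favg (\<Phi> N) (\<lambda>j. cos (real j * y) * cos (real j * x))) \<longlonglongrightarrow> 0"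
        if "AE x in M. x \<notin> A \<inter> Z"
        using that
      proof eventually_elim
        case (elim x)
        show ?case
        proof (cases "x \<in> A")
          case True
          then have Z: "x \<notin> Z" using elim by auto
          have 1: "sin ((y + x) / 2) \<noteq> 0"
          proof
            assume "sin ((y + x) / 2) = 0"
            then obtain k where "(y + x) / 2 = of_int k * pi" by (auto simp: sin_zero_iff_int2)
            then have "x = 2 * pi * of_int k - y" by (simp add: field_simps)
            with Z show False unfolding Z_def by blast
          qed
          have 2: "sin ((y - x) / 2) \<noteq> 0"
          proof
            assume "sin ((y - x) / 2) = 0"
            then obtain k where "(y - x) / 2 = of_int k * pi" by (auto simp: sin_zero_iff_int2)
            then have "x = y - 2 * pi * of_int k" by (simp add: field_simps)
            with Z show False unfolding Z_def by blast
          qed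
          have "(\<lambda>N. 1/2 * (favg (\<Phi> N) (\<lambda>j. cos (real j * (y + x))) + favg (\<Phi> N) (\<lambda>j. cos (real j * (y - x))))) \<longlonglongrightarrow> 1/2 * (0 + 0)"
            by (intro tendsto_intros folner_favg_cos fol 1 2)
          also have "(\<lambda>N. 1/2 * (favg (\<Phi> N) (\<lambda>j. cos (real j * (y + x))) + favg (\<Phi> N) (\<lambda>j. cos (real j * (y - x)))))
             = (\<lambda>N. favg (\<Phi> N) (\<lambda>j. cos (real j * y) * cos (real j * x)))"
            unfolding favg_add[symmetric] favg_cmult[symmetric]
            by (simp add: cos_add cos_diff distrib_left right_diff_distrib mult.commute)
          finally show ?thesis using True by simp
        qed simp
      qed
      show "AE x in M. norm (indicator A x * favg (\<Phi> N) (\<lambda>j. cos (real j * y) * cos (real j * x))) \<le> 1" for N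
        by (auto intro!: AE_I2 favg_abs_le mult_le_one simp: indicator_def abs_mult)
    qed (auto intro!: fm)
    then show ?thesis unfolding favg_int by simp
  qed
  have \<delta>1: "\<bar>\<delta> j\<bar> \<le> 1" for j
  proof -
    have "\<bar>\<delta> j\<bar> \<le> (\<integral>x. 1 \<partial>M)" unfolding \<delta>_def
      by (rule integral_abs_bound[THEN order_trans]) (intro integral_mono integrable_abs ind, auto simp: indicator_def)
    then show ?thesis using prob_space by simp
  qed
  \<comment> \<open>Second application: \<open>inner\<close> now provides the pointwise convergence
    of the integrand.\<close>
  have "(\<lambda>N. \<integral>x. indicator A x * favg (\<Phi> N) (\<lambda>j. \<delta> j * cos (real j * x)) \<partial>M) \<longlonglongrightarrow> (\<integral>x. 0 \<partial>M)"
  proof (intro integral_dominated_convergence[where w = "\<lambda>_. 1"])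
    show "AE x in M. (\<lambda>N. indicator A x * favg (\<Phi> N) (\<lambda>j. \<delta> j * cos (real j * x))) \<longlonglongrightarrow> 0"
    proof (rule AE_I2)
      fix x
      have "(\<lambda>N. indicator A x * favg (\<Phi> N) (\<lambda>j. cos (real j * x) * \<delta> j)) \<longlonglongrightarrow> indicator A x * 0"
        by (intro tendsto_mult tendsto_const inner)
      then show "(\<lambda>N. indicator A x * favg (\<Phi> N) (\<lambda>j. \<delta> j * cos (real j * x))) \<longlonglongrightarrow> 0"
        by (simp add: mult.commute)
    qed
    show "AE x in M. norm (indicator A x * favg (\<Phi> N) (\<lambda>j. \<delta> j * cos (real j * x))) \<le> 1" for N
      using \<delta>1 by (auto intro!: AE_I2 favg_abs_le mult_le_one simp: indicator_def abs_mult)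
  qed (auto intro!: fm)
  then show ?thesis using favg_int[of _ \<delta>] by (simp add: power2_eq_square)
qed

text \<open>The spectral measure splits into finitely many atoms \<open>\<Theta>\<close>, the
  remaining atoms of small total mass, and an atomless part. The first gives the trigonometric
  polynomial, the second is uniformly small, and the third is small off a null set by Wiener's lemma
  and Chebyshev's inequality.\<close>

lemma trigonometric_approximation:
  fixes \<gamma> :: "nat \<Rightarrow> real"
  assumes fol: "folner \<Phi>" and e: "e > 0" and le: "\<And>j. \<bar>\<gamma> j\<bar> \<le> \<gamma> 0"
    and pd: "\<And>N x. 0 \<le> (\<Sum>k<N. \<Sum>l<N. \<gamma> (nat \<bar>int k - int l\<bar>) * cos (of_int (int k - int l) * x))"
  obtains \<Theta> :: "real set" and a where "finite \<Theta>" "\<And>\<theta>. 0 \<le> a \<theta>"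
    "(\<lambda>N. favg (\<Phi> N) (indicator {j. \<bar>\<gamma> j - (\<Sum>\<theta>\<in>\<Theta>. a \<theta> * cos (real j * \<theta>))\<bar> > e})) \<longlonglongrightarrow> 0"
proof (cases "\<gamma> 0 = 0")
  \<comment> \<open>Normalising to a probability measure is impossible here, but
    \<open>\<gamma>\<close> vanishes identically.\<close>
  case True
  then have "\<gamma> j = 0" for j using le[of j] by simp
  then show ?thesis using e that[of "{}" "\<lambda>_. 0"] by (simp add: favg_def)
next
  case False
  then have \<gamma>0: "\<gamma> 0 > 0" using le[of 0] by simp
  obtain M where M: "real_distribution M" and spec: "\<And>j. \<gamma> j / \<gamma> 0 = (\<integral>x. cos (real j * x) \<partial>M)"
  proof (rule herglotz[of "\<lambda>j. \<gamma> j / \<gamma> 0"])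
    show "\<gamma> 0 / \<gamma> 0 = 1" using False by simp
    show "0 \<le> (\<Sum>k<N. \<Sum>l<N. \<gamma> (nat \<bar>int k - int l\<bar>) / \<gamma> 0 * cos (of_int (int k - int l) * x))" for N x
      using divide_nonneg_pos[OF pd[where N = N and x = x] \<gamma>0] by (simp add: sum_divide_distrib)
  qed blast
  interpret real_distribution M by (rule M)
  have [measurable_cong]: "sets M = sets borel" by simp
  define A where "A = {x. measure M {x} \<noteq> 0}"
  have cA: "countable A" unfolding A_def by (rule countable_support)
  have sb: "B \<in> sets M" if "countable B" for B
    using that by (simp add: borel_singleton sets.countable)
  \<comment> \<open>After multiplication by \<open>\<gamma> 0\<close>, mass \<open>e'\<close> costs
    \<open>e / 2\<close>; the other half is left for the atomless part.\<close>
  define e' where "e' = e / (2 * \<gamma> 0)"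
  have e': "e' > 0" using e \<gamma>0 by (simp add: e'_def)
  obtain \<Theta> where \<Theta>: "finite \<Theta>" "\<Theta> \<subseteq> A" "measure M (A - \<Theta>) < e'"
  proof (cases "A = {}")
    case True
    then show ?thesis using e' that[of "{}"] by simp
  next
    case False
    define B where "B n = from_nat_into A ` {..n}" for n
    have UB: "(\<Union>n. B n) = A"
      unfolding B_def image_UN[symmetric] UN_atMost_UNIV using range_from_nat_into[OF False cA] by simp
    have cB: "countable (B n)" for n unfolding B_def by simp
    have "(\<lambda>n. measure M (B n)) \<longlonglongrightarrow> measure M (\<Union>n. B n)"
    proof (rule finite_Lim_measure_incseq)
      show "range B \<subseteq> sets M" using sb[OF cB] by blast
      show "incseq B" by (auto simp: incseq_def B_def)
    qed
    then have "eventually (\<lambda>n. measure M A - e' < measure M (B n)) sequentially"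
      unfolding UB using e' by (intro order_tendstoD) auto
    then obtain n where n: "measure M A - e' < measure M (B n)" by (auto simp: eventually_sequentially)
    have "measure M (A - B n) = measure M A - measure M (B n)"
      using UB by (intro finite_measure_Diff sb cA cB) auto
    with n UB show ?thesis by (intro that[of "B n"]) (auto simp: B_def)
  qed
  define a where "a \<theta> = \<gamma> 0 * measure M {\<theta>}" for \<theta>
  define \<delta> where "\<delta> j = (\<integral>x. indicator (- A) x * cos (real j * x) \<partial>M)" for j :: nat
  have [measurable]: "A \<in> sets borel" "\<Theta> \<in> sets borel" "A - \<Theta> \<in> sets borel"
    using sb[OF cA] sb[of \<Theta>] \<Theta> by (auto intro: countable_finite)
  have wi: "(\<lambda>N. favg (\<Phi> N) (\<lambda>j. (\<delta> j)\<^sup>2)) \<longlonglongrightarrow> 0"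
    unfolding \<delta>_def
  proof (rule wiener[OF M fol])
    show "- A \<in> sets borel" by measurable
    show "measure M {x} = 0" if "x \<in> - A" for x using that by (simp add: A_def)
  qed
  have ind: "integrable M (\<lambda>x. indicator B x * cos (real j * x))" if [measurable]: "B \<in> sets borel" for j :: nat and B
    by (rule integrable_const_bound[where B = 1]) (auto simp: indicator_def)
  have near: "\<bar>\<gamma> j - (\<Sum>\<theta>\<in>\<Theta>. a \<theta> * cos (real j * \<theta>))\<bar> \<le> e / 2 + \<gamma> 0 * \<bar>\<delta> j\<bar>" for j
  proof -
    have "(\<integral>x. cos (real j * x) \<partial>M) = (\<integral>x. (indicator \<Theta> x * cos (real j * x) + indicator (A - \<Theta>) x * cos (real j * x))
        + indicator (- A) x * cos (real j * x) \<partial>M)"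
      using \<Theta>(2) by (intro Bochner_Integration.integral_cong) (auto simp: indicator_def)
    also have "\<dots> = (\<integral>x. indicator \<Theta> x * cos (real j * x) \<partial>M) + (\<integral>x. indicator (A - \<Theta>) x * cos (real j * x) \<partial>M) + \<delta> j"
      unfolding \<delta>_def by (simp add: ind)
    also have "(\<integral>x. indicator \<Theta> x * cos (real j * x) \<partial>M) = (\<integral>x. (\<Sum>\<theta>\<in>\<Theta>. cos (real j * \<theta>) * indicator {\<theta>} x) \<partial>M)"
    proof (intro Bochner_Integration.integral_cong refl)
      fix x
      have "(\<Sum>\<theta>\<in>\<Theta>. cos (real j * \<theta>) * indicator {\<theta>} x) = (\<Sum>\<theta>\<in>\<Theta>. if \<theta> = x then cos (real j * x) else 0)"
        by (intro sum.cong) auto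
      then show "indicator \<Theta> x * cos (real j * x) = (\<Sum>\<theta>\<in>\<Theta>. cos (real j * \<theta>) * indicator {\<theta>} x)"
        using \<Theta>(1) by (simp add: sum.delta)
    qed
    also have "\<dots> = (\<Sum>\<theta>\<in>\<Theta>. cos (real j * \<theta>) * measure M {\<theta>})"
      by (subst Bochner_Integration.integral_sum) (auto simp: emeasure_eq_measure)
    finally have \<gamma>j: "\<gamma> j = \<gamma> 0 * ((\<Sum>\<theta>\<in>\<Theta>. cos (real j * \<theta>) * measure M {\<theta>})
       + (\<integral>x. indicator (A - \<Theta>) x * cos (real j * x) \<partial>M) + \<delta> j)"
      using spec[of j] \<gamma>0 by (simp add: field_simps)
    define I where "I = (\<integral>x. indicator (A - \<Theta>) x * cos (real j * x) \<partial>M)"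
    have eq: "\<gamma> j - (\<Sum>\<theta>\<in>\<Theta>. a \<theta> * cos (real j * \<theta>)) = \<gamma> 0 * I + \<gamma> 0 * \<delta> j"
      using \<gamma>j by (simp add: a_def I_def distrib_left sum_distrib_left mult_ac)
    have "\<bar>I\<bar> \<le> (\<integral>x. indicator (A - \<Theta>) x \<partial>M)"
      unfolding I_def by (rule integral_abs_bound[THEN order_trans])
        (intro integral_mono integrable_abs ind, auto simp: abs_mult mult_left_le emeasure_eq_measure)
    also have "\<dots> \<le> e'" using \<Theta>(3) by simp
    finally have "\<gamma> 0 * \<bar>I\<bar> \<le> e / 2"
      using \<gamma>0 by (auto simp: e'_def field_simps)
    then show ?thesis
      using abs_triangle_ineq[of "\<gamma> 0 * I" "\<gamma> 0 * \<delta> j"] \<gamma>0 unfolding eq by (simp add: abs_mult)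
  qed
  let ?E = "{j. \<bar>\<gamma> j - (\<Sum>\<theta>\<in>\<Theta>. a \<theta> * cos (real j * \<theta>))\<bar> > e}"
  have ind_le: "indicator ?E j \<le> 1 / e'\<^sup>2 * (\<delta> j)\<^sup>2" for j :: nat
  proof (cases "j \<in> ?E")
    case True
    then have "e / 2 \<le> \<gamma> 0 * \<bar>\<delta> j\<bar>" using near[of j] by auto
    then have "e' \<le> \<bar>\<delta> j\<bar>" using \<gamma>0 by (simp add: e'_def field_simps)
    then have "e'\<^sup>2 \<le> (\<delta> j)\<^sup>2" using e' by (metis abs_le_square_iff abs_of_pos)
    then show ?thesis using e' True by (simp add: field_simps)
  qed simp
  have "(\<lambda>N. favg (\<Phi> N) (indicator ?E)) \<longlonglongrightarrow> 0"
  proof (rule tendsto_sandwich[OF always_eventually always_eventually])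
    show "\<forall>N. 0 \<le> favg (\<Phi> N) (indicator ?E)" by (auto simp: favg_def intro!: divide_nonneg_nonneg sum_nonneg)
    show "\<forall>N. favg (\<Phi> N) (indicator ?E) \<le> 1 / e'\<^sup>2 * favg (\<Phi> N) (\<lambda>j. (\<delta> j)\<^sup>2)"
      unfolding favg_cmult[symmetric] by (intro allI favg_mono ind_le)
    show "(\<lambda>N. 1 / e'\<^sup>2 * favg (\<Phi> N) (\<lambda>j. (\<delta> j)\<^sup>2)) \<longlonglongrightarrow> 0"
      using tendsto_mult[OF tendsto_const wi, of "1 / e'\<^sup>2"] by simp
  qed simp
  moreover have "0 \<le> a \<theta>" for \<theta> using \<gamma>0 by (simp add: a_def)
  ultimately show ?thesis using \<Theta>(1) that by blast
qed

subsection \<open>Positive definite trigonometric polynomials and Bohr sets\<close>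

text \<open>The cone spanned by the cosines: a property is checked for one cosine and then survives
  sums and nonnegative multiples. The argument is an integer because kernels are evaluated at
  differences \<open>k - n\<close>.\<close>

inductive pos_trig :: "(int \<Rightarrow> real) \<Rightarrow> bool" where
  cos: "pos_trig (\<lambda>j. cos (of_int j * x))"
| add: "pos_trig g \<Longrightarrow> pos_trig h \<Longrightarrow> pos_trig (\<lambda>j. g j + h j)"
| cmult: "0 \<le> c \<Longrightarrow> pos_trig g \<Longrightarrow> pos_trig (\<lambda>j. c * g j)"

lemma pos_trig_one: "pos_trig (\<lambda>j. 1)"
  using pos_trig.cos[of 0] by simp

text \<open>Product-to-sum has nonnegative coefficients 1/2 and therefore stays in the cone.\<close>

lemma pos_trig_cos_mult: "pos_trig h \<Longrightarrow> pos_trig (\<lambda>j. cos (of_int j * x) * h j)"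
proof (induction rule: pos_trig.induct)
  case (cos y)
  have "pos_trig (\<lambda>j. 1/2 * (cos (of_int j * (x + y)) + cos (of_int j * (x - y))))"
    by (intro pos_trig.intros) auto
  then show ?case by (simp add: distrib_left right_diff_distrib cos_add cos_diff)
next
  case (add g h)
  then show ?case using pos_trig.add by (simp add: distrib_left)
next
  case (cmult c g)
  then show ?case using pos_trig.cmult by (simp add: mult.left_commute)
qed

lemma pos_trig_mult: "pos_trig g \<Longrightarrow> pos_trig h \<Longrightarrow> pos_trig (\<lambda>j. g j * h j)"
proof (induction rule: pos_trig.induct)
  case (cos x)
  then show ?case by (rule pos_trig_cos_mult)
next
  case (add g g')
  then show ?case using pos_trig.add by (simp add: distrib_right)
next
  case (cmult c g)
  then show ?case using pos_trig.cmult by (simp add: mult.assoc)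
qed

lemma pos_trig_power: "pos_trig g \<Longrightarrow> pos_trig (\<lambda>j. g j ^ n)"
  by (induction n) (auto intro: pos_trig_one pos_trig_mult)

lemma pos_trig_prod: "(\<And>i. i \<in> I \<Longrightarrow> pos_trig (g i)) \<Longrightarrow> pos_trig (\<lambda>j. \<Prod>i\<in>I. g i j)"
  by (induction I rule: infinite_finite_induct) (auto intro: pos_trig_one pos_trig_mult)

lemma pos_trig_bounded: "pos_trig W \<Longrightarrow> \<exists>C. \<forall>j. \<bar>W j\<bar> \<le> C"
proof (induction rule: pos_trig.induct)
  case (cos x)
  then show ?case by (auto intro: exI[of _ 1])
next
  case (add g h)
  then obtain C B where "\<forall>j. \<bar>g j\<bar> \<le> C" "\<forall>j. \<bar>h j\<bar> \<le> B" by blast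
  then have "\<forall>j. \<bar>g j + h j\<bar> \<le> C + B" by (meson abs_triangle_ineq add_mono order_trans)
  then show ?case by blast
next
  case (cmult c g)
  then obtain C where "\<forall>j. \<bar>g j\<bar> \<le> C" by blast
  then have "\<forall>j. \<bar>c * g j\<bar> \<le> c * C" using cmult by (auto simp: abs_mult mult_left_mono)
  then show ?case by blast
qed

lemma bdd_pos_trig: "pos_trig W \<Longrightarrow> bdd (\<lambda>n. W (k n))"
  using pos_trig_bounded bddI by metis

text \<open>\<open>1 - cos t\<close> is half the squared distance from \<open>exp (i * t)\<close> to
  1, so it measures closeness of \<open>t\<close> to a multiple of \<open>2 * pi\<close> without any
  reduction.\<close>

definition bohr :: "real set \<Rightarrow> real \<Rightarrow> nat set" where
  "bohr \<Theta> \<eta> = {m. \<forall>\<theta>\<in>\<Theta>. 1 - cos (real m * \<theta>) < \<eta>}"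

lemma bohr_mono: "\<Theta> \<subseteq> \<Theta>' \<Longrightarrow> \<eta>' \<le> \<eta> \<Longrightarrow> bohr \<Theta>' \<eta>' \<subseteq> bohr \<Theta> \<eta>"
  by (fastforce simp: bohr_def)

lemma cos_diff_sq:
  fixes x y :: real
  shows "1 - cos (x - y) = ((cos x - cos y)\<^sup>2 + (sin x - sin y)\<^sup>2) / 2"
proof -
  have "(cos x - cos y)\<^sup>2 + (sin x - sin y)\<^sup>2
     = (cos x ^ 2 + sin x ^ 2) + (cos y ^ 2 + sin y ^ 2) - 2 * (cos x * cos y + sin x * sin y)"
    by (simp add: power2_eq_square algebra_simps)
  then show ?thesis by (simp add: cos_diff)
qed

text \<open>The triangle inequality for squared chords of the unit circle, with the factor 2 lost in
  \<open>(a - b)\<^sup>2 \<le> 2 * a\<^sup>2 + 2 * b\<^sup>2\<close>.\<close>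

lemma cos_diff_quasi_triangle:
  fixes x y :: real
  shows "1 - cos (x - y) \<le> 2 * (1 - cos x) + 2 * (1 - cos y)"
proof -
  have q: "((a::real) - b)\<^sup>2 \<le> 2 * a\<^sup>2 + 2 * b\<^sup>2" for a b
    using sum_squares_ge_zero[of "a + b" 0] by (simp add: power2_eq_square algebra_simps)
  have x: "2 * (1 - cos x) = (cos x - 1)\<^sup>2 + (sin x)\<^sup>2" for x :: real
    using cos_diff_sq[of x 0] by simp
  have "2 * (1 - cos (x - y)) = ((cos x - 1) - (cos y - 1))\<^sup>2 + (sin x - sin y)\<^sup>2"
    using cos_diff_sq[of x y] by simp
  also have "\<dots> \<le> (2 * (cos x - 1)\<^sup>2 + 2 * (cos y - 1)\<^sup>2) + (2 * (sin x)\<^sup>2 + 2 * (sin y)\<^sup>2)"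
    by (intro add_mono q)
  also have "\<dots> = 2 * (2 * (1 - cos x)) + 2 * (2 * (1 - cos y))" unfolding x by simp
  finally show ?thesis by simp
qed

text \<open>A difference of cosines is at most the chord between the angles, whence the radius
  \<open>e\<^sup>2 / 2\<close> for one frequency. Sums take the union of the frequencies and the
  smaller radius.\<close>

lemma pos_trig_almost_period:
  assumes "pos_trig W" "e > 0"
  shows "\<exists>\<Theta> \<eta>. finite \<Theta> \<and> \<eta> > 0 \<and> (\<forall>m\<in>bohr \<Theta> \<eta>. \<forall>j. \<bar>W (j + int m) - W j\<bar> \<le> e)"
  using assms
proof (induction arbitrary: e rule: pos_trig.induct)
  case (cos x)
  have "\<bar>cos (of_int (j + int m) * x) - cos (of_int j * x)\<bar> \<le> e" if m: "1 - cos (real m * x) < e\<^sup>2 / 2" for m j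
  proof -
    let ?u = "of_int (j + int m) * x" and ?v = "of_int j * x"
    have "(cos ?u - cos ?v)\<^sup>2 \<le> 2 * (1 - cos (?u - ?v))" unfolding cos_diff_sq by simp
    also have "?u - ?v = real m * x" by (simp add: algebra_simps)
    also have "2 * (1 - cos (real m * x)) \<le> e\<^sup>2" using m by simp
    finally show ?thesis using cos.prems by (metis abs_le_square_iff abs_of_pos)
  qed
  then show ?case using cos.prems by (intro exI[of _ "{x}"] exI[of _ "e\<^sup>2 / 2"]) (auto simp: bohr_def)
next
  case (add g h)
  from add.IH(1)[of "e/2"] add.prems obtain \<Theta> \<eta> where 1: "finite \<Theta>" "\<eta> > 0"
    "\<forall>m\<in>bohr \<Theta> \<eta>. \<forall>j. \<bar>g (j + int m) - g j\<bar> \<le> e/2" by auto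
  from add.IH(2)[of "e/2"] add.prems obtain \<Theta>' \<eta>' where 2: "finite \<Theta>'" "\<eta>' > 0"
    "\<forall>m\<in>bohr \<Theta>' \<eta>'. \<forall>j. \<bar>h (j + int m) - h j\<bar> \<le> e/2" by auto
  have "\<bar>g (j + int m) + h (j + int m) - (g j + h j)\<bar> \<le> e" if "m \<in> bohr (\<Theta> \<union> \<Theta>') (min \<eta> \<eta>')" for m j
  proof -
    have "m \<in> bohr \<Theta> \<eta>" "m \<in> bohr \<Theta>' \<eta>'" using that by (auto simp: bohr_def)
    then have "\<bar>g (j + int m) - g j\<bar> \<le> e/2" "\<bar>h (j + int m) - h j\<bar> \<le> e/2" using 1 2 by auto
    then show ?thesis by linarith
  qed
  then show ?case using 1 2 by (intro exI[of _ "\<Theta> \<union> \<Theta>'"] exI[of _ "min \<eta> \<eta>'"]) auto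
next
  case (cmult c g)
  \<comment> \<open>\<open>c + 1\<close> rather than \<open>c\<close>, since \<open>c\<close> may be
    0.\<close>
  have "0 < e / (c + 1)" using cmult by simp
  from cmult.IH[OF this] obtain \<Theta> \<eta> where 1: "finite \<Theta>" "\<eta> > 0"
    "\<forall>m\<in>bohr \<Theta> \<eta>. \<forall>j. \<bar>g (j + int m) - g j\<bar> \<le> e / (c + 1)" by auto
  have "\<bar>c * g (j + int m) - c * g j\<bar> \<le> e" if "m \<in> bohr \<Theta> \<eta>" for m j
  proof -
    have "\<bar>c * g (j + int m) - c * g j\<bar> = c * \<bar>g (j + int m) - g j\<bar>"
      using cmult.hyps by (simp add: abs_mult flip: right_diff_distrib)
    also have "\<dots> \<le> c * (e / (c + 1))" using 1 that cmult.hyps by (intro mult_left_mono) auto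
    also have "\<dots> \<le> e" using cmult by (simp add: field_simps)
    finally show ?thesis .
  qed
  then show ?case using 1 by blast
qed

context invariant_mean
begin

abbreviation dens :: "nat set \<Rightarrow> real" where "dens A \<equiv> \<Lambda> (indicator A)"

lemma dens_mono: "A \<subseteq> B \<Longrightarrow> dens A \<le> dens B"
  by (intro mono) (auto simp: indicator_def)

lemma dens_nonneg: "0 \<le> dens A"
  by (intro nonneg) auto

lemma dens_le_1: "dens A \<le> 1"
  using abs_le[of "indicator A" 1] by (auto simp: indicator_def abs_le_iff)

lemma dens_empty [simp]: "dens {} = 0"
proof -
  have "(indicator {} :: nat \<Rightarrow> real) = (\<lambda>_. 0)" by auto
  then show ?thesis by (simp only: const)
qed

lemma dens_Un_le: "dens (A \<union> B) \<le> dens A + dens B"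
proof -
  have "dens (A \<union> B) \<le> \<Lambda> (\<lambda>n. indicator A n + indicator B n)"
    by (intro mono bdd_add bdd_indicator) (auto simp: indicator_def)
  then show ?thesis by (simp add: add)
qed

lemma dens_shift: "dens {n. n + m \<in> A} = dens A"
proof -
  have "dens {n. n + m \<in> A} = \<Lambda> (\<lambda>n. indicator A (n + m))" by (rule arg_cong[where f = \<Lambda>]) (auto simp: indicator_def)
  then show ?thesis by (simp add: shift)
qed

text \<open>Pigeonhole: the grid cells of the points
  \<open>(cos (m * \<theta>), sin (m * \<theta>))\<close> divide all \<open>m\<close> into finitely
  many classes, so some class does not have density zero. Translating it back by one of its members
  lands in the Bohr set.\<close>

lemma bohr_dens_pos:
  assumes "finite \<Theta>" "\<eta> > 0"
  shows "0 < dens (bohr \<Theta> \<eta>)"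
proof -
  \<comment> \<open>Cells have side \<open>1 / R\<close>, so half a squared chord within a cell is
    at most \<open>1 / R\<^sup>2\<close>, which is below \<open>\<eta>\<close>.\<close>
  obtain R :: nat where R: "real R > 1 / \<eta>" using reals_Archimedean2 by blast
  with \<open>\<eta> > 0\<close> have R0: "R > 0" by (cases R) auto
  define F where "F m = (\<lambda>\<theta>\<in>\<Theta>. (\<lfloor>real R * cos (real m * \<theta>)\<rfloor>, \<lfloor>real R * sin (real m * \<theta>)\<rfloor>))" for m :: nat
  define T where "T = PiE \<Theta> (\<lambda>_. {- int R..int R} \<times> {- int R..int R})"
  have fl: "\<lfloor>real R * c\<rfloor> \<in> {- int R..int R}" if "\<bar>c\<bar> \<le> 1" for c
  proof -
    have "real R * c \<le> real R * 1" "real R * (- 1) \<le> real R * c"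
      using that by (intro mult_left_mono; simp add: abs_le_iff)+
    then show ?thesis by (auto simp: le_floor_iff floor_le_iff)
  qed
  have FT: "F m \<in> T" for m unfolding F_def T_def by (auto simp del: atLeastAtMost_iff intro!: fl)
  have finT: "finite T" unfolding T_def using assms(1) by (intro finite_PiE) auto
  have "(\<Sum>t\<in>T. dens {m. F m = t}) = \<Lambda> (\<lambda>m. \<Sum>t\<in>T. indicator {m. F m = t} m)"
    using finT by (subst sum) auto
  also have "(\<lambda>m. \<Sum>t\<in>T. indicator {m. F m = t} m) = (\<lambda>m. 1 :: real)"
    using FT finT by (auto simp: indicator_def sum.delta cong: sum.cong)
  finally have "(\<Sum>t\<in>T. dens {m. F m = t}) = 1" by simp
  then obtain t where t: "dens {m. F m = t} \<noteq> 0" by (metis sum.neutral zero_neq_one)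
  then obtain m0 where m0: "F m0 = t" by fastforce
  have "n \<in> bohr \<Theta> \<eta>" if n: "F (n + m0) = t" for n
    unfolding bohr_def
  proof (intro CollectI ballI)
    fix \<theta> assume \<theta>: "\<theta> \<in> \<Theta>"
    let ?u = "real (n + m0) * \<theta>" and ?v = "real m0 * \<theta>"
    have "F (n + m0) \<theta> = F m0 \<theta>" using n m0 by simp
    then have "\<lfloor>real R * cos ?u\<rfloor> = \<lfloor>real R * cos ?v\<rfloor>" "\<lfloor>real R * sin ?u\<rfloor> = \<lfloor>real R * sin ?v\<rfloor>"
      using \<theta> by (auto simp: F_def)
    moreover have close: "(x - y)\<^sup>2 \<le> 1 / (real R)\<^sup>2" if "\<lfloor>real R * x\<rfloor> = \<lfloor>real R * y\<rfloor>" for x y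
    proof -
      have "\<bar>real R * x - real R * y\<bar> \<le> 1" using that by linarith
      then have "(real R * x - real R * y)\<^sup>2 \<le> 1" by (simp add: abs_square_le_1)
      then show ?thesis using R0 by (simp add: field_simps power2_eq_square)
    qed
    ultimately have "1 - cos (?u - ?v) \<le> (1 / (real R)\<^sup>2 + 1 / (real R)\<^sup>2) / 2"
      unfolding cos_diff_sq by (intro divide_right_mono add_mono) auto
    also have "\<dots> \<le> 1 / real R" using R0 by (simp add: field_simps power2_eq_square)
    also have "\<dots> < \<eta>" using R R0 assms(2) by (simp add: field_simps)
    also have "?u - ?v = real n * \<theta>" by (simp add: algebra_simps)
    finally show "1 - cos (real n * \<theta>) < \<eta>" .
  qed
  then have "dens {n. n + m0 \<in> {m. F m = t}} \<le> dens (bohr \<Theta> \<eta>)" by (intro dens_mono) auto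
  then show ?thesis using t dens_nonneg[of "{m. F m = t}"] unfolding dens_shift by simp
qed

lemma bdd_pos_trig_form:
  assumes w: "pos_trig w" and f: "bdd f"
  shows "bdd (\<lambda>k. f k * w (int k - int n))" "bdd (\<lambda>n. f n * \<Lambda> (\<lambda>k. f k * w (int k - int n)))"
proof -
  show "bdd (\<lambda>k. f k * w (int k - int n))"
    using f bdd_pos_trig[OF w] by (intro bdd_mult) auto
  obtain C where C: "\<And>j. \<bar>w j\<bar> \<le> C" using pos_trig_bounded[OF w] by blast
  obtain B where B: "B > 0" "\<And>j. \<bar>f j\<bar> \<le> B" using bddE[OF f] by blast
  have "bdd (\<lambda>n. \<Lambda> (\<lambda>k. f k * w (int k - int n)))"
    by (rule bddI[of _ "B * C"], rule abs_le) (use C B in \<open>auto simp: abs_mult intro!: mult_mono\<close>)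
  with f show "bdd (\<lambda>n. f n * \<Lambda> (\<lambda>k. f k * w (int k - int n)))" by (rule bdd_mult)
qed

text \<open>For one cosine the kernel has rank at most two and the form is
  \<open>C * C + S * S\<close>, which is nonnegative. The left side vanishes unless the frequency is
  a multiple of \<open>2 * pi\<close>, and there \<open>C = \<Lambda> f\<close>. Conic combinations
  inherit the inequality.\<close>

lemma pos_trig_form_ge:
  assumes "pos_trig W" "bdd f"
  shows "(\<Lambda> f)\<^sup>2 * \<Lambda> (\<lambda>j. W (int j)) \<le> \<Lambda> (\<lambda>n. f n * \<Lambda> (\<lambda>k. f k * W (int k - int n)))"
  using assms(1)
proof (induction rule: pos_trig.induct)
  case (cos x)
  define C where "C = \<Lambda> (\<lambda>k. f k * cos (real k * x))"
  define S where "S = \<Lambda> (\<lambda>k. f k * sin (real k * x))"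
  have inner: "\<Lambda> (\<lambda>k. f k * cos (of_int (int k - int n) * x)) = C * cos (real n * x) + S * sin (real n * x)" for n
  proof -
    have "(\<lambda>k. f k * cos (of_int (int k - int n) * x))
      = (\<lambda>k. (f k * cos (real k * x)) * cos (real n * x) + (f k * sin (real k * x)) * sin (real n * x))"
      by (simp add: left_diff_distrib cos_diff algebra_simps)
    then show ?thesis unfolding C_def S_def using assms(2) by (simp add: add cmult_right bdd_mult)
  qed
  have "\<Lambda> (\<lambda>n. f n * \<Lambda> (\<lambda>k. f k * cos (of_int (int k - int n) * x)))
     = \<Lambda> (\<lambda>n. (f n * cos (real n * x)) * C + (f n * sin (real n * x)) * S)"
    unfolding inner by (simp add: algebra_simps)
  also have "\<dots> = C * C + S * S"
    using assms(2) by (simp add: add cmult_right bdd_mult flip: C_def S_def)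
  finally have eq: "\<Lambda> (\<lambda>n. f n * \<Lambda> (\<lambda>k. f k * cos (of_int (int k - int n) * x))) = C * C + S * S" .
  show ?case
  proof (cases "sin (x / 2) = 0")
    case True
    then obtain i where "x / 2 = of_int i * pi" by (auto simp: sin_zero_iff_int2)
    then have x: "x = 2 * pi * of_int i" by simp
    have "cos (real n * x) = 1" for n
      using cos_int_2pin[of "int n * i"] unfolding x by (simp add: mult_ac)
    then show ?thesis unfolding eq by (simp add: C_def power2_eq_square)
  next
    case False
    then show ?thesis unfolding eq using cos_zero[OF False] by simp
  qed
next
  case (add g h)
  show ?case
    using add.IH add.hyps assms(2) bdd_pos_trig_form
    by (simp add: invariant_mean.add[OF invariant_mean_axioms] bdd_pos_trig distrib_left)
next
  case (cmult c g)
  show ?case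
    using mult_left_mono[OF cmult.IH cmult.hyps(1)] cmult.hyps assms(2) bdd_pos_trig_form
    by (simp add: invariant_mean.cmult[OF invariant_mean_axioms] bdd_pos_trig mult.left_commute)
qed

end

subsection \<open>Intersectivity\<close>

text \<open>Greedy choice: the elements already present impose finitely many eventual conditions,
  which leave a candidate in the frequent set \<open>X\<close>; irreflexivity makes it new. The set
  \<open>L0\<close> allows a later family to be generic with respect to an earlier one.\<close>

lemma generic_finite_set:
  fixes F :: "nat filter"
  assumes freq: "\<exists>\<^sub>F m in F. m \<in> X"
    and ev: "\<And>l. l \<in> L0 \<union> X \<Longrightarrow> \<forall>\<^sub>F m in F. P l m"
    and sym: "\<And>x y. P x y \<Longrightarrow> P y x" and irrefl: "\<And>x. \<not> P x x"
    and fin: "finite L0"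
  shows "\<exists>L. finite L \<and> card L = r \<and> L \<subseteq> X \<and> (\<forall>x\<in>L. \<forall>y\<in>L. x \<noteq> y \<longrightarrow> P x y) \<and> (\<forall>x\<in>L0. \<forall>y\<in>L. P x y)"
proof (induction r)
  case 0
  then show ?case by (intro exI[of _ "{}"]) auto
next
  case (Suc r)
  then obtain L where L: "finite L" "card L = r" "L \<subseteq> X" "\<forall>x\<in>L. \<forall>y\<in>L. x \<noteq> y \<longrightarrow> P x y"
    "\<forall>x\<in>L0. \<forall>y\<in>L. P x y" by blast
  have "\<forall>\<^sub>F m in F. \<forall>l\<in>L0 \<union> L. P l m"
    using fin L(1,3) by (intro eventually_ball_finite ballI ev) auto
  with freq have "\<exists>\<^sub>F m in F. m \<in> X \<and> (\<forall>l\<in>L0 \<union> L. P l m)"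
    by (rule frequently_eventually_frequently)
  then obtain m where m: "m \<in> X" "\<forall>l\<in>L0 \<union> L. P l m" by (auto dest: frequently_ex)
  have "m \<notin> L" using m irrefl by auto
  with L m sym show ?case by (intro exI[of _ "insert m L"]) auto
qed

context invariant_mean
begin

text \<open>Second moments: otherwise there are \<open>R\<close> sets \<open>C \<inter> G x\<close>
  of density at least \<open>\<eta>\<close> whose pairwise intersections stay below
  \<open>\<eta>\<^sup>2 / 2\<close>. The mean square of their counting function is at least
  \<open>(R * \<eta>)\<^sup>2\<close> and at most \<open>R + R\<^sup>2 * \<eta>\<^sup>2 / 2\<close>,
  which is impossible for \<open>R > 2 / \<eta>\<^sup>2\<close>.\<close>

lemma intersective_step:
  fixes G :: "nat \<Rightarrow> nat set"
  assumes J: "infinite J" and \<eta>: "\<eta> > 0" and big: "\<And>N. N \<in> J \<Longrightarrow> \<eta> \<le> dens (C \<inter> G N)"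
  shows "\<exists>N\<in>J. infinite {m \<in> J. \<eta>\<^sup>2 / 2 \<le> dens (C \<inter> G N \<inter> G m)}"
proof (rule ccontr)
  assume neg: "\<not> ?thesis"
  obtain R :: nat where R: "real R > 2 / \<eta>\<^sup>2" using reals_Archimedean2 by blast
  have "0 < 2 / \<eta>\<^sup>2" using \<eta> by simp
  with R have R0: "R > 0" by (cases R) auto
  define P where "P x y \<longleftrightarrow> x \<noteq> y \<and> dens (C \<inter> G x \<inter> G y) < \<eta>\<^sup>2 / 2" for x y
  have "\<exists>L. finite L \<and> card L = R \<and> L \<subseteq> J \<and> (\<forall>x\<in>L. \<forall>y\<in>L. x \<noteq> y \<longrightarrow> P x y) \<and> (\<forall>x\<in>{}. \<forall>y\<in>L. P x y)"
  \<comment> \<open>The negated claim says that each \<open>l\<close> in \<open>J\<close> is bad for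
    only finitely many \<open>m\<close> in \<open>J\<close>; hence the cofinite filter on
    \<open>J\<close>.\<close>
  proof (rule generic_finite_set[where F = "inf cofinite (principal J)"])
    show "\<exists>\<^sub>F m in inf cofinite (principal J). m \<in> J"
      using J by (simp add: frequently_def eventually_inf_principal eventually_cofinite)
    show "\<forall>\<^sub>F m in inf cofinite (principal J). P l m" if "l \<in> {} \<union> J" for l
    proof -
      have "finite (insert l {m \<in> J. \<eta>\<^sup>2 / 2 \<le> dens (C \<inter> G l \<inter> G m)})" using that neg by auto
      moreover have "{m. \<not> (m \<in> J \<longrightarrow> P l m)} \<subseteq> insert l {m \<in> J. \<eta>\<^sup>2 / 2 \<le> dens (C \<inter> G l \<inter> G m)}"
        by (auto simp: P_def)
      ultimately show ?thesis unfolding eventually_inf_principal eventually_cofinite by (rule rev_finite_subset)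
    qed
  qed (auto simp: P_def Int_ac)
  then obtain L where L: "finite L" "card L = R" "L \<subseteq> J" "\<And>x y. x \<in> L \<Longrightarrow> y \<in> L \<Longrightarrow> x \<noteq> y \<Longrightarrow> P x y" by blast
  define S where "S n = (\<Sum>x\<in>L. indicator (C \<inter> G x) n :: real)" for n
  have bS: "bdd S" unfolding S_def[abs_def] by auto
  have "real R * \<eta> = (\<Sum>x\<in>L. \<eta>)" using L by simp
  also have "\<dots> \<le> (\<Sum>x\<in>L. dens (C \<inter> G x))" using L big by (intro sum_mono) auto
  also have "\<dots> = \<Lambda> S" unfolding S_def using L by (subst sum) auto
  finally have "(real R * \<eta>)\<^sup>2 \<le> (\<Lambda> S)\<^sup>2" using \<eta> by (intro power_mono) auto
  also have "\<dots> \<le> \<Lambda> (\<lambda>n. (S n)\<^sup>2)" by (rule square_le[OF bS])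
  also have "(\<lambda>n. (S n)\<^sup>2) = (\<lambda>n. \<Sum>x\<in>L. \<Sum>y\<in>L. indicator (C \<inter> G x \<inter> G y) n)"
  proof
    fix n
    have "(S n)\<^sup>2 = (\<Sum>x\<in>L. \<Sum>y\<in>L. indicator (C \<inter> G x) n * indicator (C \<inter> G y) n)"
      by (simp add: S_def power2_eq_square sum_product)
    also have "\<dots> = (\<Sum>x\<in>L. \<Sum>y\<in>L. indicator (C \<inter> G x \<inter> G y) n)"
      by (intro sum.cong refl) (auto simp: indicator_def)
    finally show "(S n)\<^sup>2 = (\<Sum>x\<in>L. \<Sum>y\<in>L. indicator (C \<inter> G x \<inter> G y) n)" .
  qed
  also have "\<Lambda> \<dots> = (\<Sum>x\<in>L. \<Sum>y\<in>L. dens (C \<inter> G x \<inter> G y))"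
    using L by (subst sum; auto simp: sum)
  also have "\<dots> \<le> (\<Sum>x\<in>L. \<Sum>y\<in>L. (if x = y then 1 else 0) + \<eta>\<^sup>2 / 2)"
  proof (intro sum_mono)
    fix x y assume "x \<in> L" "y \<in> L"
    then show "dens (C \<inter> G x \<inter> G y) \<le> (if x = y then 1 else 0) + \<eta>\<^sup>2 / 2"
      using L(4)[of x y] dens_le_1[of "C \<inter> G x \<inter> G y"] by (auto simp: P_def intro: order_trans)
  qed
  also have "\<dots> = real R + (real R)\<^sup>2 * \<eta>\<^sup>2 / 2"
    using L by (simp add: sum.distrib power2_eq_square algebra_simps)
  finally have "real R * (real R * \<eta>\<^sup>2) \<le> real R * 2" by (simp add: power2_eq_square algebra_simps)
  then have "real R * \<eta>\<^sup>2 \<le> 2" using R0 by simp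
  with R \<eta> show False by (simp add: field_simps)
qed

text \<open>A state is the intersection formed so far together with an infinite reservoir of indices
  whose sets meet it in density bounded below. Each step moves one index into the intersection and
  thins the reservoir.\<close>

lemma bergelson_intersectivity:
  fixes G :: "nat \<Rightarrow> nat set"
  assumes J: "infinite J" and \<eta>: "\<eta> > 0" and big: "\<And>N. N \<in> J \<Longrightarrow> \<eta> \<le> dens (G N)"
  obtains I where "I \<subseteq> J" "infinite I" "\<And>K. finite K \<Longrightarrow> K \<subseteq> I \<Longrightarrow> 0 < dens (\<Inter>N\<in>K. G N)"
proof -
  \<comment> \<open>The lower bound is existential because it shrinks from \<open>e\<close> to
    \<open>e\<^sup>2 / 2\<close> at every step.\<close>
  define ok where "ok s \<longleftrightarrow> infinite (snd s) \<and> snd s \<subseteq> J \<and> (\<exists>\<eta>>0. \<forall>N\<in>snd s. \<eta> \<le> dens (fst s \<inter> G N))"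
    for s :: "nat set \<times> nat set"
  define step where "step s t \<longleftrightarrow> (\<exists>N\<in>snd s. N \<notin> snd t \<and> snd t \<subseteq> snd s \<and> fst t = fst s \<inter> G N)"
    for s t :: "nat set \<times> nat set"
  have "\<exists>s. \<forall>n. (ok (s n) \<and> (n = 0 \<longrightarrow> s n = (UNIV, J))) \<and> step (s n) (s (Suc n))"
  proof (rule dependent_nat_choice)
    show "\<exists>x. ok x \<and> (0 = (0::nat) \<longrightarrow> x = (UNIV, J))"
      using J \<eta> big by (intro exI[of _ "(UNIV, J)"]) (auto simp: ok_def)
    fix s and n :: nat assume "ok s \<and> (n = 0 \<longrightarrow> s = (UNIV, J))"
    then obtain e where e: "infinite (snd s)" "snd s \<subseteq> J" "e > 0" "\<And>N. N \<in> snd s \<Longrightarrow> e \<le> dens (fst s \<inter> G N)"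
      by (auto simp: ok_def)
    obtain N where N: "N \<in> snd s"
      and inf: "infinite {m \<in> snd s. e\<^sup>2 / 2 \<le> dens (fst s \<inter> G N \<inter> G m)}"
      using intersective_step[OF e(1) e(3) e(4)] by (rule bexE)
    \<comment> \<open>Deleting \<open>N\<close> from the reservoir keeps the chosen indices
      distinct, so that infinitely many are collected.\<close>
    let ?t = "(fst s \<inter> G N, {m \<in> snd s. e\<^sup>2 / 2 \<le> dens (fst s \<inter> G N \<inter> G m)} - {N})"
    have "ok ?t"
      unfolding ok_def
    proof (intro conjI exI[of _ "e\<^sup>2 / 2"])
      show "infinite (snd ?t)" using inf by simp
    qed (use e in auto)
    moreover have "step s ?t" using N by (auto simp: step_def)
    ultimately show "\<exists>t. (ok t \<and> (Suc n = 0 \<longrightarrow> t = (UNIV, J))) \<and> step s t" by blast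
  qed
  then obtain s where s: "\<And>n. ok (s n)" "s 0 = (UNIV, J)" "\<And>n. step (s n) (s (Suc n))" by blast
  from s(3) obtain x where x: "\<And>n. x n \<in> snd (s n)" "\<And>n. x n \<notin> snd (s (Suc n))"
    "\<And>n. snd (s (Suc n)) \<subseteq> snd (s n)" "\<And>n. fst (s (Suc n)) = fst (s n) \<inter> G (x n)"
    unfolding step_def by metis
  have anti: "snd (s n) \<subseteq> snd (s m)" if "m \<le> n" for m n
    using that x(3) by (rule lift_Suc_antimono_le[rotated])
  have "x m \<noteq> x n" if "m < n" for m n
    using anti[of "Suc m" n] that x(1)[of n] x(2)[of m] by auto
  then have inj: "inj x" by (metis injI linorder_neqE_nat)
  have sub: "fst (s n) = (\<Inter>i<n. G (x i))" for n
    by (induction n) (auto simp: s(2) x(4) lessThan_Suc)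
  have pos: "0 < dens (fst (s n))" for n
  proof -
    obtain e where "e > 0" "\<forall>N\<in>snd (s n). e \<le> dens (fst (s n) \<inter> G N)" using s(1)[of n] by (auto simp: ok_def)
    then have "0 < dens (fst (s n) \<inter> G (x n))" using x(1)[of n] by force
    also have "\<dots> \<le> dens (fst (s n))" by (rule dens_mono) auto
    finally show ?thesis .
  qed
  show thesis
  proof (rule that[of "range x"])
    show "range x \<subseteq> J" using x(1) s(1) by (auto simp: ok_def)
    show "infinite (range x)" using inj by (simp add: range_inj_infinite)
    fix K assume K: "finite K" "K \<subseteq> range x"
    then obtain k where k: "finite k" "K = x ` k" by (meson finite_subset_image)
    then obtain n where "k \<subseteq> {..<n}" by (meson finite_nat_iff_bounded)
    then have "fst (s n) \<subseteq> (\<Inter>N\<in>K. G N)" using k sub by auto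
    with pos[of n] show "0 < dens (\<Inter>N\<in>K. G N)" by (meson dens_mono less_le_trans)
  qed
qed

text \<open>The filter generated by \<open>\<G>\<close> and all sets whose complement has density
  zero. It differs from \<open>bot\<close> exactly when finite intersections from
  \<open>\<G>\<close> have nonzero density; \<open>dens_filter {}\<close> describes properties that
  hold off a null set.\<close>

definition dens_filter :: "nat set set \<Rightarrow> nat filter" where
  "dens_filter \<G> = Abs_filter (\<lambda>P. \<exists>K. finite K \<and> K \<subseteq> \<G> \<and> dens (\<Inter>K \<inter> {x. \<not> P x}) = 0)"

lemma eventually_dens_filter:
  "eventually P (dens_filter \<G>) \<longleftrightarrow> (\<exists>K. finite K \<and> K \<subseteq> \<G> \<and> dens (\<Inter>K \<inter> {x. \<not> P x}) = 0)"
  unfolding dens_filter_def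
proof (rule eventually_Abs_filter, rule is_filter.intro)
  show "\<exists>K. finite K \<and> K \<subseteq> \<G> \<and> dens (\<Inter>K \<inter> {x. \<not> True}) = 0"
    by (intro exI[of _ "{}"]) auto
next
  fix P Q
  assume "\<exists>K. finite K \<and> K \<subseteq> \<G> \<and> dens (\<Inter>K \<inter> {x. \<not> P x}) = 0"
    and "\<exists>K. finite K \<and> K \<subseteq> \<G> \<and> dens (\<Inter>K \<inter> {x. \<not> Q x}) = 0"
  then obtain K K' where K: "finite K" "K \<subseteq> \<G>" "dens (\<Inter>K \<inter> {x. \<not> P x}) = 0"
    and K': "finite K'" "K' \<subseteq> \<G>" "dens (\<Inter>K' \<inter> {x. \<not> Q x}) = 0" by blast
  have "dens (\<Inter>(K \<union> K') \<inter> {x. \<not> (P x \<and> Q x)}) \<le> dens ((\<Inter>K \<inter> {x. \<not> P x}) \<union> (\<Inter>K' \<inter> {x. \<not> Q x}))"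
    by (rule dens_mono) auto
  also have "\<dots> \<le> 0" using dens_Un_le[of "\<Inter>K \<inter> {x. \<not> P x}" "\<Inter>K' \<inter> {x. \<not> Q x}"] K K' by simp
  finally show "\<exists>K. finite K \<and> K \<subseteq> \<G> \<and> dens (\<Inter>K \<inter> {x. \<not> (P x \<and> Q x)}) = 0"
    using K K' dens_nonneg by (intro exI[of _ "K \<union> K'"]) (auto intro: antisym)
next
  fix P Q :: "nat \<Rightarrow> bool"
  assume imp: "\<forall>x. P x \<longrightarrow> Q x" and "\<exists>K. finite K \<and> K \<subseteq> \<G> \<and> dens (\<Inter>K \<inter> {x. \<not> P x}) = 0"
  then obtain K where K: "finite K" "K \<subseteq> \<G>" "dens (\<Inter>K \<inter> {x. \<not> P x}) = 0" by blast
  have "dens (\<Inter>K \<inter> {x. \<not> Q x}) \<le> dens (\<Inter>K \<inter> {x. \<not> P x})" using imp by (intro dens_mono) auto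
  with K show "\<exists>K. finite K \<and> K \<subseteq> \<G> \<and> dens (\<Inter>K \<inter> {x. \<not> Q x}) = 0"
    using dens_nonneg by (intro exI[of _ K]) (auto intro: antisym)
qed

lemma dens_filter_le: "dens_filter \<G> \<le> dens_filter {}"
  unfolding le_filter_def eventually_dens_filter by auto

text \<open>Finite sets have density zero, because a shift moves every index past their
  elements.\<close>

lemma dens_filter_le_sequentially: "dens_filter {} \<le> sequentially"
  unfolding le_filter_def eventually_sequentially
proof (intro allI impI)
  fix P :: "nat \<Rightarrow> bool" assume "\<exists>N. \<forall>n\<ge>N. P n"
  then obtain N where N: "\<forall>n\<ge>N. P n" by blast
  then have "{n. n + N \<in> {x. \<not> P x}} = {}" by auto
  then have "dens {x. \<not> P x} = 0" using dens_shift[of N "{x. \<not> P x}"] by simp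
  then show "eventually P (dens_filter {})" unfolding eventually_dens_filter by (intro exI[of _ "{}"]) auto
qed

lemma frequently_dens_filter: "0 < dens X \<Longrightarrow> \<exists>\<^sub>F m in dens_filter {}. m \<in> X"
  unfolding frequently_def eventually_dens_filter by auto

section \<open>Autocorrelations under an invariant mean\<close>

lemma corr_shift: "bdd f \<Longrightarrow> \<Lambda> (\<lambda>n. f (n + l) * f (n + m)) = \<Lambda> (\<lambda>n. f n * f (n + nat \<bar>int l - int m\<bar>))"
proof (induction l m rule: linorder_wlog)
  case (le l m)
  have "\<Lambda> (\<lambda>n. f (n + l) * f (n + l + (m - l))) = \<Lambda> (\<lambda>n. f n * f (n + (m - l)))"
    using shift[OF bdd_mult[OF le.prems bdd_shift[OF le.prems]]] by blast
  then show ?case using le by (simp add: nat_diff_distrib')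
next
  case (sym l m)
  then show ?case by (simp add: mult.commute abs_minus_commute)
qed

lemma corr_le:
  assumes "bdd f" shows "\<bar>\<Lambda> (\<lambda>n. f n * f (n + m))\<bar> \<le> \<Lambda> (\<lambda>n. f n * f n)"
proof -
  have ff: "bdd (\<lambda>n. f n * f n)" "bdd (\<lambda>n. f n * f (n + m))" "bdd (\<lambda>n. f (n + m) * f (n + m))"
    using assms by auto
  have s: "\<Lambda> (\<lambda>n. f (n + m) * f (n + m)) = \<Lambda> (\<lambda>n. f n * f n)" using shift[OF ff(1)] .
  have "2 * \<Lambda> (\<lambda>n. f n * f (n + m)) = \<Lambda> (\<lambda>n. 2 * (f n * f (n + m)))" using ff by (simp add: cmult)
  also have "\<dots> \<le> \<Lambda> (\<lambda>n. f n * f n + f (n + m) * f (n + m))"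
    using ff sum_squares_bound by (intro mono) (auto simp: power2_eq_square mult.assoc)
  also have "\<dots> = 2 * \<Lambda> (\<lambda>n. f n * f n)" using ff s by (simp add: add)
  finally have 1: "\<Lambda> (\<lambda>n. f n * f (n + m)) \<le> \<Lambda> (\<lambda>n. f n * f n)" by simp
  have "(-2) * \<Lambda> (\<lambda>n. f n * f (n + m)) = \<Lambda> (\<lambda>n. (-2) * (f n * f (n + m)))" using ff by (intro cmult[symmetric])
  also have "\<dots> \<le> \<Lambda> (\<lambda>n. f n * f n + f (n + m) * f (n + m))"
  proof (intro mono)
    show "-2 * (f n * f (n + m)) \<le> f n * f n + f (n + m) * f (n + m)" for n
      using sum_squares_bound[of "f n" "- f (n + m)"] by (simp add: power2_eq_square)
  qed (use ff in auto)
  also have "\<dots> = 2 * \<Lambda> (\<lambda>n. f n * f n)" using ff s by (simp add: add)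
  finally show ?thesis using 1 by (simp add: abs_le_iff)
qed

text \<open>The double sum is the mean of the squared modulus of
  \<open>\<Sum>k<N. f (n + k) * exp (i * k * x)\<close>, written through its real and imaginary
  parts.\<close>

lemma corr_positive_definite:
  assumes "bdd f"
  shows "0 \<le> (\<Sum>k<N. \<Sum>l<N. \<Lambda> (\<lambda>n. f n * f (n + nat \<bar>int k - int l\<bar>)) * cos (of_int (int k - int l) * x))"
proof -
  have b: "bdd (\<lambda>n. f (n + k) * f (n + l) * c)" for k l c
    using assms by auto
  have "(\<Sum>k<N. \<Sum>l<N. \<Lambda> (\<lambda>n. f n * f (n + nat \<bar>int k - int l\<bar>)) * cos (of_int (int k - int l) * x))
     = (\<Sum>k<N. \<Sum>l<N. \<Lambda> (\<lambda>n. f (n + k) * f (n + l) * cos (of_int (int k - int l) * x)))"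
    using assms by (intro sum.cong refl) (subst cmult_right, auto simp: corr_shift)
  also have "\<dots> = \<Lambda> (\<lambda>n. \<Sum>k<N. \<Sum>l<N. f (n + k) * f (n + l) * cos (of_int (int k - int l) * x))"
    using b by (simp add: sum bdd_sum)
  also have "(\<lambda>n. \<Sum>k<N. \<Sum>l<N. f (n + k) * f (n + l) * cos (of_int (int k - int l) * x))
     = (\<lambda>n. (\<Sum>k<N. f (n + k) * cos (real k * x))\<^sup>2 + (\<Sum>k<N. f (n + k) * sin (real k * x))\<^sup>2)"
    unfolding power2_eq_square sum_product sum.distrib[symmetric]
    by (intro ext sum.cong refl) (simp add: left_diff_distrib cos_diff algebra_simps)
  also have "0 \<le> \<Lambda> \<dots>"
    using assms by (intro nonneg) auto
  finally show ?thesis .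
qed

text \<open>In the expanded square \<open>a\<close> cancels: what remains are the errors
  \<open>e\<close> and the diagonal terms, only \<open>r\<close> out of \<open>r\<^sup>2\<close> in
  each family. Two generic families are thus close in mean square even if they are chosen at
  different stages.\<close>

lemma gram_distance:
  assumes f: "bdd f" and L: "finite L" "card L = r" and L0: "finite L0" "card L0 = r" and r: "r > 0"
    and e: "0 \<le> a + e"
    and LL: "\<And>x y. x \<in> L \<Longrightarrow> y \<in> L \<Longrightarrow> x \<noteq> y \<Longrightarrow> \<Lambda> (\<lambda>n. f (n + x) * f (n + y)) \<le> a + e"
    and L00: "\<And>x y. x \<in> L0 \<Longrightarrow> y \<in> L0 \<Longrightarrow> x \<noteq> y \<Longrightarrow> \<Lambda> (\<lambda>n. f (n + x) * f (n + y)) \<le> a + e"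
    and L0L: "\<And>x y. x \<in> L0 \<Longrightarrow> y \<in> L \<Longrightarrow> a - e \<le> \<Lambda> (\<lambda>n. f (n + x) * f (n + y))"
  shows "\<Lambda> (\<lambda>n. ((\<Sum>x\<in>L0. f (n + x)) / real r - (\<Sum>x\<in>L. f (n + x)) / real r)\<^sup>2)
     \<le> 2 * \<Lambda> (\<lambda>n. f n * f n) / real r + 4 * e"
proof -
  define g where "g x y = \<Lambda> (\<lambda>n. f (n + x) * f (n + y))" for x y
  have b: "bdd (\<lambda>n. f (n + x) * f (n + y))" for x y using f by auto
  have gxx: "g x x = \<Lambda> (\<lambda>n. f n * f n)" for x unfolding g_def by (simp add: corr_shift[OF f])
  have prod: "\<Lambda> (\<lambda>n. (\<Sum>x\<in>A. f (n + x)) * (\<Sum>x\<in>B. f (n + x))) = (\<Sum>x\<in>A. \<Sum>y\<in>B. g x y)"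
    if "finite A" "finite B" for A B
    unfolding sum_product g_def using that b by (simp add: sum bdd_sum)
  have diag: "(\<Sum>x\<in>A. \<Sum>y\<in>A. g x y) \<le> real r * \<Lambda> (\<lambda>n. f n * f n) + (real r)\<^sup>2 * (a + e)"
    if A: "finite A" "card A = r" and le: "\<And>x y. x \<in> A \<Longrightarrow> y \<in> A \<Longrightarrow> x \<noteq> y \<Longrightarrow> g x y \<le> a + e" for A
  proof -
    have "(\<Sum>x\<in>A. \<Sum>y\<in>A. g x y) \<le> (\<Sum>x\<in>A. \<Sum>y\<in>A. (if x = y then \<Lambda> (\<lambda>n. f n * f n) else 0) + (a + e))"
    proof (intro sum_mono)
      fix x y assume "x \<in> A" "y \<in> A"
      then show "g x y \<le> (if x = y then \<Lambda> (\<lambda>n. f n * f n) else 0) + (a + e)"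
        using le[of x y] e by (cases "x = y") (auto simp: gxx)
    qed
    also have "\<dots> = real r * \<Lambda> (\<lambda>n. f n * f n) + (real r)\<^sup>2 * (a + e)"
      using A by (simp add: sum.distrib power2_eq_square algebra_simps)
    finally show ?thesis .
  qed
  have cross: "(real r)\<^sup>2 * (a - e) \<le> (\<Sum>x\<in>L0. \<Sum>y\<in>L. g x y)"
  proof -
    have "(real r)\<^sup>2 * (a - e) = (\<Sum>x\<in>L0. \<Sum>y\<in>L. a - e)" using L L0 by (simp add: power2_eq_square)
    also have "\<dots> \<le> (\<Sum>x\<in>L0. \<Sum>y\<in>L. g x y)" unfolding g_def by (intro sum_mono L0L)
    finally show ?thesis .
  qed
  let ?s = "\<lambda>A n. \<Sum>x\<in>A. f (n + x)"
  have bs: "bdd (\<lambda>n. ?s A n * ?s B n)" for A B using f by auto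
  have "\<Lambda> (\<lambda>n. (?s L0 n / real r - ?s L n / real r)\<^sup>2)
     = \<Lambda> (\<lambda>n. (?s L0 n * ?s L0 n + (?s L n * ?s L n - 2 * (?s L0 n * ?s L n))) * (1 / (real r)\<^sup>2))"
    by (rule arg_cong[where f = \<Lambda>]) (simp add: fun_eq_iff power2_eq_square algebra_simps add_divide_distrib diff_divide_distrib)
  also have "\<dots> = ((\<Sum>x\<in>L0. \<Sum>y\<in>L0. g x y) + ((\<Sum>x\<in>L. \<Sum>y\<in>L. g x y) - 2 * (\<Sum>x\<in>L0. \<Sum>y\<in>L. g x y))) * (1 / (real r)\<^sup>2)"
    using bs L L0 by (simp only: cmult_right add diff cmult bdd_add bdd_diff bdd_mult bdd_const prod)
  also have "\<dots> \<le> (2 * (real r * \<Lambda> (\<lambda>n. f n * f n)) + (real r)\<^sup>2 * (4 * e)) * (1 / (real r)\<^sup>2)"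
  proof (intro mult_right_mono)
    have "(\<Sum>x\<in>L0. \<Sum>y\<in>L0. g x y) \<le> real r * \<Lambda> (\<lambda>n. f n * f n) + (real r)\<^sup>2 * (a + e)"
      by (rule diag) (use L0 L00 in \<open>auto simp: g_def\<close>)
    moreover have "(\<Sum>x\<in>L. \<Sum>y\<in>L. g x y) \<le> real r * \<Lambda> (\<lambda>n. f n * f n) + (real r)\<^sup>2 * (a + e)"
      by (rule diag) (use L LL in \<open>auto simp: g_def\<close>)
    ultimately show "(\<Sum>x\<in>L0. \<Sum>y\<in>L0. g x y) + ((\<Sum>x\<in>L. \<Sum>y\<in>L. g x y) - 2 * (\<Sum>x\<in>L0. \<Sum>y\<in>L. g x y))
      \<le> 2 * (real r * \<Lambda> (\<lambda>n. f n * f n)) + (real r)\<^sup>2 * (4 * e)"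
      using cross by (simp add: algebra_simps)
  qed simp
  also have "\<dots> = 2 * \<Lambda> (\<lambda>n. f n * f n) / real r + 4 * e"
    using r by (simp add: field_simps power2_eq_square)
  finally show ?thesis .
qed

end

subsection \<open>Concentrated kernels and generic shifts\<close>

context invariant_mean
begin

text \<open>The kernel is a high power of \<open>\<Prod>\<theta>\<in>\<Theta>. (1 + cos (j * \<theta>)) / 2\<close>, which peaks on the Bohr set.\<close>

lemma concentrated_kernel:
  assumes fin: "finite \<Theta>" and \<eta>: "0 < \<eta>" "\<eta> \<le> 1" and e: "0 < e"
  obtains W where "pos_trig W" "\<And>j. 0 \<le> W j" "\<And>j. W j \<le> 1" "0 < \<Lambda> (\<lambda>k. W (int k))"
    "\<And>m. m \<notin> bohr \<Theta> \<eta> \<Longrightarrow> W (int m) \<le> e * \<Lambda> (\<lambda>k. W (int k))"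
proof -
  define Q where "Q j = (\<Prod>\<theta>\<in>\<Theta>. 1/2 * (1 + cos (of_int j * \<theta>)))" for j :: int
  have factor: "0 \<le> 1/2 * (1 + cos x)" for x :: real using cos_ge_minus_one[of x] by argo
  have factor': "1/2 * (1 + cos x) \<le> 1" for x :: real using cos_le_one[of x] by argo
  have Q: "pos_trig Q" unfolding Q_def[abs_def]
    by (intro pos_trig_prod pos_trig.intros pos_trig_one) auto
  have Q01: "0 \<le> Q j" "Q j \<le> 1" for j
    unfolding Q_def by (intro prod_nonneg prod_le_1 ballI conjI factor factor')+
  have Q0: "Q 0 = 1" by (simp add: Q_def)
  have off: "Q (int m) \<le> 1 - \<eta> / 2" if m: "m \<notin> bohr \<Theta> \<eta>" for m
  proof -
    obtain \<theta> where \<theta>: "\<theta> \<in> \<Theta>" "\<eta> \<le> 1 - cos (real m * \<theta>)" using m by (auto simp: bohr_def not_less)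
    have "Q (int m) = 1/2 * (1 + cos (real m * \<theta>)) * (\<Prod>\<theta>\<in>\<Theta> - {\<theta>}. 1/2 * (1 + cos (real m * \<theta>)))"
      unfolding Q_def using fin \<theta>(1) by (subst prod.remove[of _ \<theta>]) auto
    also have "\<dots> \<le> 1/2 * (1 + cos (real m * \<theta>)) * 1"
      by (intro mult_left_mono prod_le_1 conjI factor factor')
    also have "\<dots> \<le> 1 - \<eta> / 2" using \<theta>(2) by simp
    finally show ?thesis .
  qed
  have "\<eta> / 4 > 0" using \<eta> by simp
  then obtain \<Theta>1 \<eta>1 where 1: "finite \<Theta>1" "\<eta>1 > 0" "\<forall>m\<in>bohr \<Theta>1 \<eta>1. \<forall>j. \<bar>Q (j + int m) - Q j\<bar> \<le> \<eta> / 4"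
    using pos_trig_almost_period[OF Q] by blast
  have on: "1 - \<eta> / 4 \<le> Q (int m)" if "m \<in> bohr \<Theta>1 \<eta>1" for m
  proof -
    have "\<bar>Q (0 + int m) - Q 0\<bar> \<le> \<eta> / 4" using 1 that by blast
    then show ?thesis unfolding Q0 abs_diff_le_iff by simp
  qed
  define b where "b = dens (bohr \<Theta>1 \<eta>1)"
  have b: "0 < b" unfolding b_def using bohr_dens_pos 1 by blast
  \<comment> \<open>\<open>Q\<close> is at least \<open>u\<close> on a Bohr set of density
    \<open>b\<close> and at most \<open>v\<close> off the target one, so a power with
    \<open>(v / u) ^ n < b * e\<close> makes the tail negligible against the mean. The bound
    \<open>\<eta> \<le> 1\<close> keeps \<open>v\<close> positive.\<close>
  define u where "u = 1 - \<eta> / 4"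
  define v where "v = 1 - \<eta> / 2"
  have uv: "0 < v" "v < u" "0 < u" using \<eta> by (auto simp: u_def v_def)
  have "0 < b * e" using b e by simp
  moreover have "v / u < 1" using uv by simp
  ultimately obtain n where n: "(v / u) ^ n < b * e" using real_arch_pow_inv by blast
  define W where "W j = Q j ^ n" for j
  have W: "pos_trig W" unfolding W_def[abs_def] by (rule pos_trig_power[OF Q])
  have "u ^ n * b = \<Lambda> (\<lambda>k. u ^ n * indicator (bohr \<Theta>1 \<eta>1) k)" unfolding b_def by (simp add: cmult)
  also have "\<dots> \<le> \<Lambda> (\<lambda>k. W (int k))"
  proof (intro mono bdd_pos_trig[OF W])
    show "u ^ n * indicator (bohr \<Theta>1 \<eta>1) k \<le> W (int k)" for k
      using on[of k] uv Q01(1)[of "int k"] unfolding W_def u_def[symmetric]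
      by (cases "k \<in> bohr \<Theta>1 \<eta>1") (auto intro: power_mono)
  qed auto
  finally have c: "u ^ n * b \<le> \<Lambda> (\<lambda>k. W (int k))" .
  show thesis
  proof (rule that[OF W])
    show "0 \<le> W j" "W j \<le> 1" for j using Q01[of j] by (auto simp: W_def power_le_one)
    show "0 < \<Lambda> (\<lambda>k. W (int k))" using c b uv by (meson less_le_trans mult_pos_pos zero_less_power)
    fix m assume "m \<notin> bohr \<Theta> \<eta>"
    then have "W (int m) \<le> v ^ n" unfolding W_def v_def by (intro power_mono off Q01)
    also have "\<dots> \<le> e * (u ^ n * b)"
      using n uv by (simp add: power_divide divide_less_eq mult_ac)
    also have "\<dots> \<le> e * \<Lambda> (\<lambda>k. W (int k))" using c e by (intro mult_left_mono) auto
    finally show "W (int m) \<le> e * \<Lambda> (\<lambda>k. W (int k))" .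
  qed
qed

text \<open>Each \<open>x\<close> in \<open>L\<close> is almost a period of \<open>W\<close>, so
  \<open>\<psi> (n + x)\<close> replaces \<open>\<psi> n\<close> at cost \<open>M * e\<close>.
  Invariance then removes the shift by \<open>x\<close> and leaves the bound for the quadratic
  form.\<close>

lemma kernel_average_ge:
  assumes W: "pos_trig W" and f0: "\<And>n. 0 \<le> f n" and fM: "\<And>n. f n \<le> M"
    and L: "finite L" "card L = r" "0 < r"
    and ap: "\<And>x j. x \<in> L \<Longrightarrow> \<bar>W (j + int x) - W j\<bar> \<le> e"
  shows "(\<Lambda> f)\<^sup>2 * \<Lambda> (\<lambda>k. W (int k)) - M * (M * e)
    \<le> \<Lambda> (\<lambda>n. (\<Sum>x\<in>L. f (n + x)) / real r * \<Lambda> (\<lambda>k. f (n + k) * W (int k)))"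
proof -
  have f: "bdd f" using f0 fM by (intro bddI[of _ M]) simp
  have M: "0 \<le> M" using f0 fM order_trans by blast
  define \<psi> where "\<psi> n = \<Lambda> (\<lambda>k. f k * W (int k - int n))" for n
  note b = bdd_pos_trig_form[OF W f]
  have \<psi>: "\<Lambda> (\<lambda>k. f (n + k) * W (int k)) = \<psi> n" for n
    using shift[OF b(1)[of n], of n] by (simp add: \<psi>_def add.commute)
  have b\<psi>: "bdd \<psi>"
  proof -
    obtain C where C: "\<And>j. \<bar>W j\<bar> \<le> C" using pos_trig_bounded[OF W] by blast
    show ?thesis unfolding \<psi>_def
    proof (rule bddI[of _ "M * C"], rule abs_le)
      show "\<bar>f k * W (int k - int n)\<bar> \<le> M * C" for k n
        unfolding abs_mult using C f0 fM M by (intro mult_mono) auto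
    qed
  qed
  have close: "\<bar>\<psi> (n + x) - \<psi> n\<bar> \<le> M * e" if x: "x \<in> L" for n x
  proof -
    have "\<psi> (n + x) - \<psi> n = \<Lambda> (\<lambda>k. f k * W (int k - int (n + x)) - f k * W (int k - int n))"
      unfolding \<psi>_def by (rule diff[symmetric]) (rule b)+
    also have "\<bar>\<dots>\<bar> \<le> M * e"
    proof (rule abs_le)
      fix k
      have "\<bar>W (int k - int (n + x)) - W (int k - int n)\<bar> \<le> e"
        using ap[OF x, of "int k - int (n + x)"] by (simp add: abs_minus_commute)
      then show "\<bar>f k * W (int k - int (n + x)) - f k * W (int k - int n)\<bar> \<le> M * e"
        unfolding right_diff_distrib[symmetric] abs_mult using f0 fM M by (intro mult_mono) auto
    qed
    finally show ?thesis .
  qed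
  have each: "(\<Lambda> f)\<^sup>2 * \<Lambda> (\<lambda>k. W (int k)) - M * (M * e) \<le> \<Lambda> (\<lambda>n. f (n + x) * \<psi> n)" if x: "x \<in> L" for x
  proof -
    have "(\<Lambda> f)\<^sup>2 * \<Lambda> (\<lambda>k. W (int k)) \<le> \<Lambda> (\<lambda>n. f n * \<psi> n)"
      unfolding \<psi>_def by (rule pos_trig_form_ge[OF W f])
    also have "\<dots> = \<Lambda> (\<lambda>n. f (n + x) * \<psi> (n + x))"
      by (rule shift[OF bdd_mult[OF f b\<psi>], symmetric])
    finally have "(\<Lambda> f)\<^sup>2 * \<Lambda> (\<lambda>k. W (int k)) - M * (M * e) \<le> \<Lambda> (\<lambda>n. f (n + x) * \<psi> (n + x) - M * (M * e))"
      using bdd_mult[OF bdd_shift[OF f] bdd_shift[OF b\<psi>]] by (simp add: diff)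
    also have "\<dots> \<le> \<Lambda> (\<lambda>n. f (n + x) * \<psi> n)"
    proof (intro mono)
      fix n
      have "\<bar>f (n + x) * (\<psi> (n + x) - \<psi> n)\<bar> \<le> M * (M * e)"
        unfolding abs_mult using close[OF x, of n] f0 fM M by (intro mult_mono) auto
      then show "f (n + x) * \<psi> (n + x) - M * (M * e) \<le> f (n + x) * \<psi> n"
        by (simp add: algebra_simps abs_le_iff)
    qed (use f b\<psi> in auto)
    finally show ?thesis .
  qed
  have "real r * ((\<Lambda> f)\<^sup>2 * \<Lambda> (\<lambda>k. W (int k)) - M * (M * e)) \<le> (\<Sum>x\<in>L. \<Lambda> (\<lambda>n. f (n + x) * \<psi> n))"
    using sum_mono[OF each, of L "\<lambda>x. x"] L by simp
  also have "\<dots> = \<Lambda> (\<lambda>n. \<Sum>x\<in>L. f (n + x) * \<psi> n)"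
    using L f b\<psi> by (subst sum) auto
  also have "\<dots> = \<Lambda> (\<lambda>n. real r * ((\<Sum>x\<in>L. f (n + x)) / real r * \<psi> n))"
    using L by (simp add: sum_distrib_right)
  also have "\<dots> = real r * \<Lambda> (\<lambda>n. (\<Sum>x\<in>L. f (n + x)) / real r * \<psi> n)"
    by (rule cmult) (use f b\<psi> in \<open>auto\<close>)
  finally show ?thesis unfolding \<psi> using L by simp
qed

text \<open>A weighted Markov inequality: the excess \<open>a k - s\<close> is at most
  \<open>B\<close> on the superlevel set and negative on the rest of \<open>D\<close>; outside
  \<open>D\<close> the weight is so small that at most half of the total excess
  \<open>\<Lambda> W * \<eta>\<close> comes from there.\<close>

lemma dens_superlevel_ge:
  assumes W: "\<And>k. 0 \<le> W k" "\<And>k. W k \<le> 1" and a: "bdd a" "\<And>k. a k - s \<le> B" and B: "0 < B"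
    and off: "\<And>k. k \<notin> D \<Longrightarrow> W k \<le> \<eta> / (2 * B) * \<Lambda> W" and \<eta>: "0 < \<eta>"
    and ge: "\<Lambda> W * (s + \<eta>) \<le> \<Lambda> (\<lambda>k. W k * a k)"
  shows "\<Lambda> W * \<eta> / (2 * B) \<le> dens {k \<in> D. s \<le> a k}"
proof -
  let ?G = "{k \<in> D. s \<le> a k}"
  have bW: "bdd W" using W by (intro bddI[of _ 1]) simp
  have c: "0 \<le> \<Lambda> W" using bW W by (intro nonneg)
  have "\<Lambda> (\<lambda>k. W k * a k) \<le> \<Lambda> (\<lambda>k. W k * s + (B * indicator ?G k + \<Lambda> W * \<eta> / 2))"
  proof (intro mono)
    fix k
    have "W k * (a k - s) \<le> B * indicator ?G k + \<Lambda> W * \<eta> / 2"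
    proof (cases "k \<in> ?G")
      case True
      then have "W k * (a k - s) \<le> 1 * B" using W a(2) by (intro mult_mono) auto
      then show ?thesis using True c \<eta> by (simp add: add_increasing2)
    next
      case G: False
      have "W k * (a k - s) \<le> \<Lambda> W * \<eta> / 2"
      proof (cases "k \<in> D")
        case True
        then have "W k * (a k - s) \<le> 0" using G W by (intro mult_nonneg_nonpos) auto
        also have "\<dots> \<le> \<Lambda> W * \<eta> / 2" using c \<eta> by simp
        finally show ?thesis .
      next
        case False
        have "W k * (a k - s) \<le> W k * B" by (intro mult_left_mono a W)
        also have "\<dots> \<le> (\<eta> / (2 * B) * \<Lambda> W) * B" using off[OF False] B by (intro mult_right_mono) auto
        also have "\<dots> = \<Lambda> W * \<eta> / 2" using B by simp
        finally show ?thesis .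
      qed
      then show ?thesis using G by simp
    qed
    then show "W k * a k \<le> W k * s + (B * indicator ?G k + \<Lambda> W * \<eta> / 2)" by (simp add: algebra_simps)
  qed (use bW a in auto)
  also have "\<dots> = \<Lambda> W * s + (B * dens ?G + \<Lambda> W * \<eta> / 2)"
    using bW by (simp add: add cmult cmult_right bdd_mult bdd_add)
  finally have "\<Lambda> W * \<eta> / 2 \<le> B * dens ?G" using ge by (simp add: algebra_simps)
  then show ?thesis using B by (simp add: field_simps)
qed

text \<open>If \<open>m - l\<close> avoids the exceptional null set and both shifts lie in the Bohr
  set, every \<open>cos ((m - l) * \<theta>)\<close> is near 1, so the correlation is near the
  coefficient sum \<open>a\<close>, the same for all such pairs. As the coefficients are
  nonnegative, the deviation of the polynomial is at most \<open>4 * \<eta> * a\<close>.\<close>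

lemma generic_correlation:
  assumes f: "bdd f" and fol: "folner \<Phi>" and \<kappa>: "0 < \<kappa>"
    and null: "\<And>E. (\<lambda>N. favg (\<Phi> N) (indicator E)) \<longlonglongrightarrow> 0 \<Longrightarrow> dens E = 0"
  obtains \<Theta> \<eta> a where "finite \<Theta>" "0 < \<eta>" "\<eta> \<le> 1" "0 \<le> a"
    "\<And>l. \<forall>\<^sub>F m in dens_filter {}. l \<noteq> m \<and>
       (l \<in> bohr \<Theta> \<eta> \<longrightarrow> m \<in> bohr \<Theta> \<eta> \<longrightarrow> \<bar>\<Lambda> (\<lambda>n. f (n + l) * f (n + m)) - a\<bar> \<le> \<kappa>)"
proof -
  define \<gamma> where "\<gamma> j = \<Lambda> (\<lambda>n. f n * f (n + j))" for j
  have "\<kappa> / 2 > 0" using \<kappa> by simp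
  then obtain \<Theta> c where \<Theta>: "finite \<Theta>" and c: "\<And>\<theta>. 0 \<le> c \<theta>"
    and lim: "(\<lambda>N. favg (\<Phi> N) (indicator {j. \<bar>\<gamma> j - (\<Sum>\<theta>\<in>\<Theta>. c \<theta> * cos (real j * \<theta>))\<bar> > \<kappa> / 2})) \<longlonglongrightarrow> 0"
  proof (rule trigonometric_approximation[OF fol, where \<gamma> = \<gamma>])
    show "\<bar>\<gamma> j\<bar> \<le> \<gamma> 0" for j using corr_le[OF f] by (simp add: \<gamma>_def)
    show "0 \<le> (\<Sum>k<N. \<Sum>l<N. \<gamma> (nat \<bar>int k - int l\<bar>) * cos (of_int (int k - int l) * x))" for N x
      unfolding \<gamma>_def by (rule corr_positive_definite[OF f])
  qed blast
  define E where "E = {j. \<bar>\<gamma> j - (\<Sum>\<theta>\<in>\<Theta>. c \<theta> * cos (real j * \<theta>))\<bar> > \<kappa> / 2}"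
  have E: "dens E = 0" using null lim by (simp add: E_def)
  define a where "a = (\<Sum>\<theta>\<in>\<Theta>. c \<theta>)"
  have a: "0 \<le> a" unfolding a_def by (intro sum_nonneg c)
  \<comment> \<open>The quasi-triangle inequality turns the radius into \<open>4 * \<eta>\<close>;
    \<open>a + 1\<close> avoids division by 0, and the cap 1 is a condition of the kernel
    construction.\<close>
  define \<eta> where "\<eta> = min 1 (\<kappa> / (8 * (a + 1)))"
  have \<eta>: "0 < \<eta>" "\<eta> \<le> 1" using \<kappa> a by (auto simp: \<eta>_def)
  have \<eta>a: "4 * \<eta> * a \<le> \<kappa> / 2"
  proof -
    have "4 * \<eta> * a \<le> 4 * (\<kappa> / (8 * (a + 1))) * a" using a by (intro mult_right_mono mult_left_mono) (auto simp: \<eta>_def)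
    also have "\<dots> \<le> \<kappa> / 2" using a \<kappa> by (simp add: field_simps)
    finally show ?thesis .
  qed
  have good: "\<bar>\<Lambda> (\<lambda>n. f (n + l) * f (n + m)) - a\<bar> \<le> \<kappa>"
    if lm: "l < m" "m - l \<notin> E" "l \<in> bohr \<Theta> \<eta>" "m \<in> bohr \<Theta> \<eta>" for l m
  proof -
    define j where "j = m - l"
    let ?\<tau> = "\<Sum>\<theta>\<in>\<Theta>. c \<theta> * cos (real j * \<theta>)"
    have "\<Lambda> (\<lambda>n. f (n + l) * f (n + m)) = \<gamma> j"
    proof -
      have "nat \<bar>int l - int m\<bar> = j" using lm(1) unfolding j_def by linarith
      then show ?thesis unfolding \<gamma>_def using corr_shift[OF f, of l m] by (simp only:)
    qed
    moreover have "\<bar>\<gamma> j - ?\<tau>\<bar> \<le> \<kappa> / 2" using lm(2) by (simp add: E_def j_def)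
    moreover have "\<bar>?\<tau> - a\<bar> \<le> \<kappa> / 2"
    proof -
      have t: "1 - cos (real j * \<theta>) \<le> 4 * \<eta>" if "\<theta> \<in> \<Theta>" for \<theta>
      proof -
        have "real j * \<theta> = real m * \<theta> - real l * \<theta>" using lm(1) by (simp add: j_def of_nat_diff left_diff_distrib)
        then have "1 - cos (real j * \<theta>) \<le> 2 * (1 - cos (real m * \<theta>)) + 2 * (1 - cos (real l * \<theta>))"
          using cos_diff_quasi_triangle[of "real m * \<theta>" "real l * \<theta>"] by simp
        moreover have "1 - cos (real m * \<theta>) < \<eta>" "1 - cos (real l * \<theta>) < \<eta>"
          using lm that by (auto simp: bohr_def)
        ultimately show ?thesis by argo
      qed
      have "a - ?\<tau> = (\<Sum>\<theta>\<in>\<Theta>. c \<theta> * (1 - cos (real j * \<theta>)))"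
        by (simp add: a_def right_diff_distrib sum_subtractf)
      moreover have "0 \<le> (\<Sum>\<theta>\<in>\<Theta>. c \<theta> * (1 - cos (real j * \<theta>)))"
        by (intro sum_nonneg mult_nonneg_nonneg c) auto
      moreover have "(\<Sum>\<theta>\<in>\<Theta>. c \<theta> * (1 - cos (real j * \<theta>))) \<le> (\<Sum>\<theta>\<in>\<Theta>. c \<theta> * (4 * \<eta>))"
        by (intro sum_mono mult_left_mono t c)
      moreover have "(\<Sum>\<theta>\<in>\<Theta>. c \<theta> * (4 * \<eta>)) = 4 * \<eta> * a" by (simp add: a_def sum_distrib_right mult.commute)
      ultimately show ?thesis using \<eta>a by linarith
    qed
    ultimately show ?thesis by linarith
  qed
  have "\<forall>\<^sub>F m in dens_filter {}. l \<noteq> m \<and>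
     (l \<in> bohr \<Theta> \<eta> \<longrightarrow> m \<in> bohr \<Theta> \<eta> \<longrightarrow> \<bar>\<Lambda> (\<lambda>n. f (n + l) * f (n + m)) - a\<bar> \<le> \<kappa>)" for l
  proof -
    let ?P = "\<lambda>m. l \<noteq> m \<and> (l \<in> bohr \<Theta> \<eta> \<longrightarrow> m \<in> bohr \<Theta> \<eta> \<longrightarrow> \<bar>\<Lambda> (\<lambda>n. f (n + l) * f (n + m)) - a\<bar> \<le> \<kappa>)"
    \<comment> \<open>Only \<open>m > l\<close> has to be examined: the shift by
      \<open>Suc l\<close> discards the rest without changing the density, and \<open>m - l\<close>
      becomes \<open>n + 1\<close>.\<close>
    have "{n. n + Suc l \<in> {m. \<not> ?P m}} \<subseteq> {n. n + 1 \<in> E}"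
    proof
      fix n assume n: "n \<in> {n. n + Suc l \<in> {m. \<not> ?P m}}"
      show "n \<in> {n. n + 1 \<in> E}"
      proof (rule ccontr)
        assume "n \<notin> {n. n + 1 \<in> E}"
        then have "(n + Suc l) - l \<notin> E" by simp
        then have "?P (n + Suc l)" using good[of l "n + Suc l"] by simp
        with n show False by blast
      qed
    qed
    then have "dens {n. n + Suc l \<in> {m. \<not> ?P m}} \<le> dens {n. n + 1 \<in> E}" by (rule dens_mono)
    then have "dens {m. \<not> ?P m} = 0"
      unfolding dens_shift using E dens_nonneg[of "{m. \<not> ?P m}"] by simp
    then show ?thesis unfolding eventually_dens_filter by (intro exI[of _ "{}"]) auto
  qed
  with \<Theta> \<eta> a that show thesis by blast
qed

end

section \<open>Construction of the ultrafilter and the subsequence\<close>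

text \<open>Convergence of all correlations along \<open>\<Phi>\<close> forces every mean built from
  a later ultrafilter on the indices to give the same \<open>g\<close>. Families of shifts picked
  before and after \<open>p\<close> can then be compared through one Gram matrix.\<close>

lemma recurrence_along_convergent_folner:
  fixes f :: "nat \<Rightarrow> real"
  assumes f0: "\<And>n. 0 \<le> f n" and fM: "\<And>n. f n \<le> M" and M: "0 < M" and fol: "folner \<Phi>"
    and lim_f: "(\<lambda>N. favg (\<Phi> N) f) \<longlonglongrightarrow> d"
    and lim_g: "\<And>l m. (\<lambda>N. favg (\<Phi> N) (\<lambda>n. f (n + l) * f (n + m))) \<longlonglongrightarrow> g l m"
    and \<epsilon>: "0 < \<epsilon>"
  obtains r p b where "strict_mono r" "is_ultrafilter p" "nonprincipal p"
    "\<And>m. (\<lambda>N. favg (\<Phi> (r N)) (\<lambda>n. f (n + m) * shiftU p f n)) \<longlonglongrightarrow> b m"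
    "d\<^sup>2 - \<epsilon> \<le> ulim p b"
proof -
  have bf: "bdd f" using f0 fM by (intro bddI[of _ M]) simp
  obtain U where U: "is_ultrafilter U" "U \<le> sequentially"
    using ultrafilter_below[of sequentially] by auto
  have nbU: "U \<noteq> bot" using U(1) by (rule ultrafilter_not_bot)
  define \<Lambda> where "\<Lambda> = folner_mean U \<Phi>"
  interpret invariant_mean \<Lambda> unfolding \<Lambda>_def by (rule invariant_mean_folner[OF U fol])
  have \<Lambda>_lim: "\<Lambda> h = x" if "(\<lambda>N. favg (\<Phi> N) h) \<longlonglongrightarrow> x" for h x
    unfolding \<Lambda>_def using that by (rule folner_mean_eqI[OF U])
  have \<Lambda>f: "\<Lambda> f = d" by (rule \<Lambda>_lim[OF lim_f])
  have \<Lambda>g: "\<Lambda> (\<lambda>n. f (n + l) * f (n + m)) = g l m" for l m by (rule \<Lambda>_lim[OF lim_g])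

  \<comment> \<open>Five losses: almost periodicity of \<open>W\<close>, the passage from the limit
    to single \<open>N\<close>, the superlevel sets, the replacement of \<open>w\<close> by
    \<open>y\<close>, and the values of \<open>b\<close> on \<open>X\<close>.\<close>
  define \<epsilon>' where "\<epsilon>' = \<epsilon> / 5"
  have \<epsilon>': "0 < \<epsilon>'" using \<epsilon> by (simp add: \<epsilon>'_def)
  \<comment> \<open>A mean square distance \<open>\<kappa>\<close> gives mean distance
    \<open>\<epsilon>' / M\<close>, hence \<open>\<epsilon>'\<close> after pairing with a function
    bounded by \<open>M\<close>.\<close>
  define \<kappa> where "\<kappa> = (\<epsilon>' / M)\<^sup>2"
  have \<kappa>: "0 < \<kappa>" using \<epsilon>' M by (simp add: \<kappa>_def)
  then have "0 < \<kappa> / 8" by simp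
  then obtain \<Theta> \<eta> a where \<Theta>: "finite \<Theta>" and \<eta>: "0 < \<eta>" "\<eta> \<le> 1" and a: "0 \<le> a"
    and gen: "\<And>l. \<forall>\<^sub>F m in dens_filter {}. l \<noteq> m \<and>
       (l \<in> bohr \<Theta> \<eta> \<longrightarrow> m \<in> bohr \<Theta> \<eta> \<longrightarrow> \<bar>g l m - a\<bar> \<le> \<kappa> / 8)"
    using generic_correlation[OF bf fol, of "\<kappa> / 8"] \<Lambda>_lim unfolding \<Lambda>g by blast
  define D where "D = bohr \<Theta> \<eta>"
  define P where "P l m \<longleftrightarrow> l \<noteq> m \<and> (l \<in> D \<longrightarrow> m \<in> D \<longrightarrow> \<bar>g l m - a\<bar> \<le> \<kappa> / 8)" for l m
  have evP: "\<forall>\<^sub>F m in dens_filter {}. P l m" for l using gen unfolding P_def D_def .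
  have g_sym: "g l m = g m l" for l m unfolding \<Lambda>g[symmetric] by (simp add: mult.commute)
  have P_sym: "P l m \<Longrightarrow> P m l" for l m unfolding P_def using g_sym by metis
  have P_irrefl: "\<not> P l l" for l by (simp add: P_def)

  \<comment> \<open>Bounds the excess \<open>A N k - (d\<^sup>2 - 3 * \<epsilon>')\<close>, since
    \<open>A N k \<le> M * M\<close>.\<close>
  define B where "B = M * M + 3 * \<epsilon>'"
  have B: "0 < B" using M \<epsilon>' by (simp add: B_def add_pos_pos)
  have "0 < \<epsilon>' / (2 * B)" using B \<epsilon>' by simp
  then obtain W where W: "pos_trig W" and W01: "\<And>j. 0 \<le> W j" "\<And>j. W j \<le> 1"
    and c0: "0 < \<Lambda> (\<lambda>k. W (int k))"
    and off: "\<And>m. m \<notin> D \<Longrightarrow> W (int m) \<le> \<epsilon>' / (2 * B) * \<Lambda> (\<lambda>k. W (int k))"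
    using concentrated_kernel[OF \<Theta> \<eta>] unfolding D_def by metis
  define c where "c = \<Lambda> (\<lambda>k. W (int k))"
  have c: "0 < c" using c0 by (simp add: c_def)
  have bW: "bdd (\<lambda>k. W (int k))" by (rule bdd_pos_trig[OF W])

  have "0 < c * \<epsilon>' / (M * M)" using c \<epsilon>' M by simp
  then obtain \<Theta>2 \<eta>2 where ap: "finite \<Theta>2" "\<eta>2 > 0"
    "\<forall>m\<in>bohr \<Theta>2 \<eta>2. \<forall>j. \<bar>W (j + int m) - W j\<bar> \<le> c * \<epsilon>' / (M * M)"
    using pos_trig_almost_period[OF W] by blast
  \<comment> \<open>Generic shifts from \<open>X0\<close> have mutual correlations near
    \<open>a\<close> and are also almost periods of \<open>W\<close>.\<close>
  define X0 where "X0 = bohr (\<Theta> \<union> \<Theta>2) (min \<eta> \<eta>2)"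
  have X0: "X0 \<subseteq> D" "X0 \<subseteq> bohr \<Theta>2 \<eta>2" unfolding X0_def D_def by (rule bohr_mono; simp)+
  have "0 < dens X0" unfolding X0_def using \<Theta> \<eta> ap by (intro bohr_dens_pos) auto
  then have freq0: "\<exists>\<^sub>F m in dens_filter {}. m \<in> X0" by (rule frequently_dens_filter)

  \<comment> \<open>The diagonal terms then contribute at most \<open>\<kappa> / 2\<close> to the
    squared distance; the errors \<open>\<kappa> / 8\<close> supply the other half.\<close>
  obtain r :: nat where r: "real r > 4 * \<Lambda> (\<lambda>n. f n * f n) / \<kappa>" using reals_Archimedean2 by blast
  have "0 \<le> \<Lambda> (\<lambda>n. f n * f n)" using bf f0 by (intro nonneg) auto
  then have "0 \<le> 4 * \<Lambda> (\<lambda>n. f n * f n) / \<kappa>" using \<kappa> by simp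
  with r have r0: "0 < r" by linarith
  obtain L0 where L0: "finite L0" "card L0 = r" "L0 \<subseteq> X0" "\<And>x y. x \<in> L0 \<Longrightarrow> y \<in> L0 \<Longrightarrow> x \<noteq> y \<Longrightarrow> P x y"
    using generic_finite_set[of X0 "dens_filter {}" "{}" P r, OF freq0 evP P_sym P_irrefl] by auto
  define w where "w n = (\<Sum>x\<in>L0. f (n + x)) / real r" for n
  have w0: "0 \<le> w n" for n unfolding w_def by (intro divide_nonneg_nonneg sum_nonneg f0) auto
  have wM: "w n \<le> M" for n
  proof -
    have "(\<Sum>x\<in>L0. f (n + x)) \<le> real (card L0) * M" by (rule sum_bounded_above) (rule fM)
    then show ?thesis unfolding w_def using r0 L0(2) by (simp add: field_simps)
  qed
  have bw: "bdd w" using w0 wM by (intro bddI[of _ M]) simp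

  define \<psi> where "\<psi> n = \<Lambda> (\<lambda>k. f (n + k) * W (int k))" for n
  have bfW: "bdd (\<lambda>k. f (n + k) * W (int k))" for n
    using bdd_mult[OF bdd_shift[OF bf, of n] bW] by (simp add: add.commute)
  have b\<psi>: "bdd \<psi>"
    unfolding \<psi>_def
  proof (rule bddI[of _ M], rule abs_le)
    show "\<bar>f (n + k) * W (int k)\<bar> \<le> M" for n k
      using mult_mono[OF fM[of "n + k"] W01(2)[of "int k"]] f0 W01(1) M by (simp add: abs_mult)
  qed
  have big: "c * (d\<^sup>2 - \<epsilon>') \<le> \<Lambda> (\<lambda>n. w n * \<psi> n)"
  proof -
    have "(\<Lambda> f)\<^sup>2 * \<Lambda> (\<lambda>k. W (int k)) - M * (M * (c * \<epsilon>' / (M * M))) \<le> \<Lambda> (\<lambda>n. w n * \<psi> n)"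
      unfolding w_def \<psi>_def using ap(3) L0(3) X0(2)
      by (intro kernel_average_ge[OF W f0 fM L0(1,2) r0]) blast
    moreover have "M * (M * (c * \<epsilon>' / (M * M))) = c * \<epsilon>'" using M by simp
    ultimately show ?thesis by (simp add: \<Lambda>f c_def algebra_simps)
  qed

  define A where "A N k = favg (\<Phi> N) (\<lambda>n. w n * f (n + k))" for N k
  have A0: "\<bar>A N k\<bar> \<le> M * M" for N k
    unfolding A_def by (rule favg_abs_le) (use w0 wM f0 fM M in \<open>auto simp: abs_mult intro!: mult_mono\<close>)
  have bA: "bdd (A N)" for N by (rule bddI[OF A0])
  \<comment> \<open>\<open>\<Phi> N\<close> is finite, so finite additivity suffices to interchange
    the average over \<open>n\<close> with the mean over \<open>k\<close>.\<close>
  have AW: "favg (\<Phi> N) (\<lambda>n. w n * \<psi> n) = \<Lambda> (\<lambda>k. W (int k) * A N k)" for N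
  proof -
    have fin: "finite (\<Phi> N)" using fol by (simp add: folner_def)
    have "\<Lambda> (\<lambda>k. W (int k) * A N k) = \<Lambda> (\<lambda>k. \<Sum>n\<in>\<Phi> N. (w n / real (card (\<Phi> N))) * (f (n + k) * W (int k)))"
      by (rule arg_cong[where f = \<Lambda>])
        (simp add: fun_eq_iff A_def favg_def sum_divide_distrib sum_distrib_left mult_ac)
    also have "\<dots> = (\<Sum>n\<in>\<Phi> N. (w n / real (card (\<Phi> N))) * \<psi> n)"
      unfolding \<psi>_def cmult[OF bfW, symmetric] by (rule sum[OF fin bdd_mult[OF bdd_const bfW]])
    also have "\<dots> = favg (\<Phi> N) (\<lambda>n. w n * \<psi> n)"
      by (simp add: favg_def sum_divide_distrib)
    finally show ?thesis by simp
  qed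
  define J where "J = {N. c * (d\<^sup>2 - 2 * \<epsilon>') \<le> favg (\<Phi> N) (\<lambda>n. w n * \<psi> n)}"
  have "eventually (\<lambda>N. c * (d\<^sup>2 - 2 * \<epsilon>') < favg (\<Phi> N) (\<lambda>n. w n * \<psi> n)) U"
  proof (rule order_tendstoD)
    show "((\<lambda>N. favg (\<Phi> N) (\<lambda>n. w n * \<psi> n)) \<longlongrightarrow> \<Lambda> (\<lambda>n. w n * \<psi> n)) U"
      unfolding \<Lambda>_def using bw b\<psi> unfolding \<Lambda>_def by (intro folner_mean_tendsto U) auto
    have "c * (d\<^sup>2 - 2 * \<epsilon>') < c * (d\<^sup>2 - \<epsilon>')" using c \<epsilon>' by simp
    with big show "c * (d\<^sup>2 - 2 * \<epsilon>') < \<Lambda> (\<lambda>n. w n * \<psi> n)" by simp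
  qed
  then have evJ: "eventually (\<lambda>N. N \<in> J) U" by eventually_elim (simp add: J_def)
  have infJ: "infinite J"
  proof
    assume "finite J"
    then obtain N0 where N0: "\<forall>N\<in>J. N < N0" by (auto simp: finite_nat_iff_bounded)
    have "eventually (\<lambda>N. N0 \<le> N) U" using U(2) eventually_ge_at_top by (rule filter_leD)
    with evJ have "eventually (\<lambda>N. False) U" by eventually_elim (use N0 in force)
    with nbU show False by simp
  qed
  define G where "G N = {k \<in> D. d\<^sup>2 - 3 * \<epsilon>' \<le> A N k}" for N
  have densG: "c * \<epsilon>' / (2 * B) \<le> dens (G N)" if "N \<in> J" for N
    unfolding G_def c_def
  proof (rule dens_superlevel_ge)
    show "A N k - (d\<^sup>2 - 3 * \<epsilon>') \<le> B" for k using A0[of N k] zero_le_power2[of d] unfolding B_def by linarith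
    show "\<Lambda> (\<lambda>k. W (int k)) * (d\<^sup>2 - 3 * \<epsilon>' + \<epsilon>') \<le> \<Lambda> (\<lambda>k. W (int k) * A N k)"
      using that unfolding J_def AW c_def by simp
  qed (use W01 bA B off \<epsilon>' in auto)
  have densG_pos: "0 < c * \<epsilon>' / (2 * B)" using c \<epsilon>' B by simp
  obtain I where I: "I \<subseteq> J" "infinite I" "\<And>K. finite K \<Longrightarrow> K \<subseteq> I \<Longrightarrow> 0 < dens (\<Inter>N\<in>K. G N)"
    by (rule bergelson_intersectivity[OF infJ densG_pos densG]) blast+

  have "dens_filter (G ` I) \<noteq> bot"
    unfolding trivial_limit_def eventually_dens_filter
  proof
    assume "\<exists>K. finite K \<and> K \<subseteq> G ` I \<and> dens (\<Inter>K \<inter> {x. \<not> False}) = 0"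
    then obtain K where K: "finite K" "K \<subseteq> G ` I" "dens (\<Inter>K) = 0" by auto
    then obtain K' where "finite K'" "K' \<subseteq> I" "K = G ` K'" by (meson finite_subset_image)
    with I(3)[of K'] K(3) show False by simp
  qed
  then obtain p where p: "p \<le> dens_filter (G ` I)" "is_ultrafilter p" by (rule ultrafilter_below)
  \<comment> \<open>Every set in \<open>p\<close> thus has positive density, which gives
    nonprincipality and, later, room for generic choices.\<close>
  have p': "p \<le> dens_filter {}" using p(1) dens_filter_le by (rule order_trans)
  have "p \<le> sequentially" using p' dens_filter_le_sequentially by (rule order_trans)
  then have np: "nonprincipal p" using nonprincipal_le_sequentially[OF p(2)] by simp
  have nbp: "p \<noteq> bot" using p(2) by (rule ultrafilter_not_bot)
  have pG: "eventually (\<lambda>k. k \<in> G N) p" if "N \<in> I" for N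
  proof (rule filter_leD[OF p(1)])
    have "\<Inter>{G N} \<inter> {x. x \<notin> G N} = {}" by auto
    then show "eventually (\<lambda>k. k \<in> G N) (dens_filter (G ` I))"
      unfolding eventually_dens_filter using that by (intro exI[of _ "{G N}"]) simp
  qed
  obtain N1 where "N1 \<in> I" using I(2) by (metis finite.emptyI ex_in_conv)
  from pG[OF this] have pD: "eventually (\<lambda>k. k \<in> D) p" by eventually_elim (simp add: G_def)

  define v where "v = shiftU p f"
  have v_lim: "((\<lambda>k. f (n + k)) \<longlongrightarrow> v n) p" for n
    unfolding v_def shiftU_def
  proof (rule ultrafilter_tendsto[OF p(2)])
    have "bdd (\<lambda>k. f (n + k))" using bdd_shift[OF bf, of n] by (simp add: add.commute)
    then show "bounded (range (\<lambda>k. f (n + k)))" by (simp add: bdd_def)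
  qed
  have v0: "0 \<le> v n" for n
    by (rule tendsto_lowerbound[OF v_lim _ nbp]) (simp add: f0)
  have vM: "v n \<le> M" for n
    by (rule tendsto_upperbound[OF v_lim _ nbp]) (simp add: fM)
  have bv: "bdd v" using v0 vM by (intro bddI[of _ M]) simp
  \<comment> \<open>For one \<open>N\<close> the average is a finite sum, so the limit along
    \<open>p\<close> passes inside.\<close>
  have Iv: "d\<^sup>2 - 3 * \<epsilon>' \<le> favg (\<Phi> N) (\<lambda>n. w n * v n)" if N: "N \<in> I" for N
  proof (rule tendsto_lowerbound[OF _ _ nbp])
    show "(A N \<longlongrightarrow> favg (\<Phi> N) (\<lambda>n. w n * v n)) p"
      unfolding A_def favg_def by (intro tendsto_intros v_lim) (use fol in \<open>auto simp: folner_def\<close>)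
    show "eventually (\<lambda>k. d\<^sup>2 - 3 * \<epsilon>' \<le> A N k) p"
      using pG[OF N] by eventually_elim (simp add: G_def)
  qed

  \<comment> \<open>Only now is \<open>v\<close> available. An ultrafilter on the indices in
    \<open>I\<close> yields a mean to which the bound \<open>Iv\<close> carries over.\<close>
  have "inf sequentially (principal I) \<noteq> bot"
    using I(2) by (simp add: trivial_limit_def eventually_inf_principal eventually_sequentially
        infinite_nat_iff_unbounded_le)
  then obtain V where V: "V \<le> inf sequentially (principal I)" "is_ultrafilter V" by (rule ultrafilter_below)
  have V': "V \<le> sequentially" and VI: "eventually (\<lambda>N. N \<in> I) V"
    using V(1) by (auto simp: le_inf_iff le_principal)
  have nbV: "V \<noteq> bot" using V(2) by (rule ultrafilter_not_bot)
  define \<Lambda>' where "\<Lambda>' = folner_mean V \<Phi>"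
  interpret m: invariant_mean \<Lambda>' unfolding \<Lambda>'_def by (rule invariant_mean_folner[OF V(2) V' fol])
  have \<Lambda>'g: "\<Lambda>' (\<lambda>n. f (n + l) * f (n + m)) = g l m" for l m
    unfolding \<Lambda>'_def by (rule folner_mean_eqI[OF V(2) V' lim_g])
  define b where "b m = \<Lambda>' (\<lambda>n. f (n + m) * v n)" for m
  have bfv: "bdd (\<lambda>n. f (n + m) * v n)" for m using bf bv by auto
  obtain q where q: "strict_mono q" "\<And>k. q k \<in> I"
    "\<And>m. (\<lambda>k. favg (\<Phi> (q k)) (\<lambda>n. f (n + m) * v n)) \<longlonglongrightarrow> ulim V (\<lambda>N. favg (\<Phi> N) (\<lambda>n. f (n + m) * v n))"
  proof (rule subsequence_of_ultrafilter[OF V(2) V' VI, of "\<lambda>m N. favg (\<Phi> N) (\<lambda>n. f (n + m) * v n)"])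
    show "bounded (range (\<lambda>N. favg (\<Phi> N) (\<lambda>n. f (n + m) * v n)))" for m
      using bdd_favg[OF bfv] by (simp add: bdd_def)
  qed blast
  have b_le: "\<bar>b m\<bar> \<le> M * M" for m
    unfolding b_def by (rule m.abs_le) (use v0 vM f0 fM M in \<open>auto simp: abs_mult intro!: mult_mono\<close>)
  have b_lim: "(b \<longlongrightarrow> ulim p b) p"
    using bddI[OF b_le] by (intro ultrafilter_tendsto[OF p(2)]) (simp add: bdd_def)
  have wv: "d\<^sup>2 - 3 * \<epsilon>' \<le> \<Lambda>' (\<lambda>n. w n * v n)"
  proof (rule tendsto_lowerbound[OF _ _ nbV])
    show "((\<lambda>N. favg (\<Phi> N) (\<lambda>n. w n * v n)) \<longlongrightarrow> \<Lambda>' (\<lambda>n. w n * v n)) V"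
      unfolding \<Lambda>'_def using bw bv by (intro folner_mean_tendsto V(2)) auto
    show "eventually (\<lambda>N. d\<^sup>2 - 3 * \<epsilon>' \<le> favg (\<Phi> N) (\<lambda>n. w n * v n)) V"
      using VI by eventually_elim (rule Iv)
  qed

  \<comment> \<open>\<open>X\<close> belongs to \<open>p\<close>, so it is frequent for the density
    filter and supplies shifts generic against \<open>L0\<close>. There \<open>b\<close> barely
    exceeds its limit, so averaging over such shifts bounds the correlation of \<open>y\<close> with
    \<open>v\<close> from above.\<close>
  define X where "X = {m \<in> D. b m < ulim p b + \<epsilon>'}"
  have "eventually (\<lambda>m. m \<in> X) p"
    using pD order_tendstoD(2)[OF b_lim, of "ulim p b + \<epsilon>'"] \<epsilon>' unfolding X_def
    by (auto intro: eventually_conj)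
  then have "\<exists>\<^sub>F m in p. m \<in> X" using nbp by (rule eventually_frequently[rotated])
  then have freqX: "\<exists>\<^sub>F m in dens_filter {}. m \<in> X"
    using p' unfolding frequently_def le_filter_def by blast
  obtain L where L: "finite L" "card L = r" "L \<subseteq> X" "\<And>x y. x \<in> L \<Longrightarrow> y \<in> L \<Longrightarrow> x \<noteq> y \<Longrightarrow> P x y"
    "\<And>x y. x \<in> L0 \<Longrightarrow> y \<in> L \<Longrightarrow> P x y"
    using generic_finite_set[of X "dens_filter {}" L0 P r, OF freqX evP P_sym P_irrefl L0(1)] by auto
  define y where "y n = (\<Sum>x\<in>L. f (n + x)) / real r" for n
  have b_y: "bdd y" unfolding y_def[abs_def] using bf by auto
  have PD: "a - \<kappa> / 8 \<le> g l m \<and> g l m \<le> a + \<kappa> / 8" if "P l m" "l \<in> D" "m \<in> D" for l m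
    using that unfolding P_def abs_diff_le_iff by blast
  have LD: "L \<subseteq> D" "L0 \<subseteq> D" using L(3) L0(3) X0(1) by (auto simp: X_def)
  have "\<Lambda>' (\<lambda>n. (w n - y n)\<^sup>2) \<le> 2 * \<Lambda>' (\<lambda>n. f n * f n) / real r + 4 * (\<kappa> / 8)"
    unfolding w_def y_def
  proof (rule m.gram_distance[OF bf L(1,2) L0(1,2) r0, of a])
    show "0 \<le> a + \<kappa> / 8" using a \<kappa> by simp
    show "\<Lambda>' (\<lambda>n. f (n + x) * f (n + y)) \<le> a + \<kappa> / 8" if "x \<in> L" "y \<in> L" "x \<noteq> y" for x y
      using PD[OF L(4)[OF that]] that LD unfolding \<Lambda>'g by blast
    show "\<Lambda>' (\<lambda>n. f (n + x) * f (n + y)) \<le> a + \<kappa> / 8" if "x \<in> L0" "y \<in> L0" "x \<noteq> y" for x y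
      using PD[OF L0(4)[OF that]] that LD unfolding \<Lambda>'g by blast
    show "a - \<kappa> / 8 \<le> \<Lambda>' (\<lambda>n. f (n + x) * f (n + y))" if "x \<in> L0" "y \<in> L" for x y
      using PD[OF L(5)[OF that]] that LD unfolding \<Lambda>'g by blast
  qed
  also have "\<dots> \<le> \<kappa>"
  proof -
    have "\<Lambda>' (\<lambda>n. f n * f n) = \<Lambda> (\<lambda>n. f n * f n)" using \<Lambda>'g[of 0 0] \<Lambda>g[of 0 0] by simp
    then show ?thesis using r r0 \<kappa> by (simp add: field_simps)
  qed
  finally have dist: "\<Lambda>' (\<lambda>n. (w n - y n)\<^sup>2) \<le> \<kappa>" .
  have "(\<Lambda>' (\<lambda>n. \<bar>w n - y n\<bar>))\<^sup>2 \<le> \<Lambda>' (\<lambda>n. \<bar>w n - y n\<bar>\<^sup>2)"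
    using bw b_y by (intro m.square_le) auto
  also have "\<dots> \<le> (\<epsilon>' / M)\<^sup>2" using dist by (simp add: \<kappa>_def)
  finally have dist1: "\<Lambda>' (\<lambda>n. \<bar>w n - y n\<bar>) \<le> \<epsilon>' / M"
    by (rule power2_le_imp_le) (use \<epsilon>' M in simp)
  have "\<Lambda>' (\<lambda>n. w n * v n) \<le> \<Lambda>' (\<lambda>n. y n * v n + \<bar>w n - y n\<bar> * M)"
  proof (intro m.mono)
    fix n
    have "(w n - y n) * v n \<le> \<bar>w n - y n\<bar> * M" using v0 vM by (intro mult_mono) auto
    then show "w n * v n \<le> y n * v n + \<bar>w n - y n\<bar> * M" by (simp add: algebra_simps)
  qed (use bw b_y bv in auto)
  also have "\<dots> = \<Lambda>' (\<lambda>n. y n * v n) + \<Lambda>' (\<lambda>n. \<bar>w n - y n\<bar>) * M"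
    using bw b_y bv by (subst m.add) (auto simp: m.cmult_right bdd_abs bdd_diff)
  finally have wy: "\<Lambda>' (\<lambda>n. w n * v n) \<le> \<Lambda>' (\<lambda>n. y n * v n) + \<Lambda>' (\<lambda>n. \<bar>w n - y n\<bar>) * M" .
  have dist2: "\<Lambda>' (\<lambda>n. \<bar>w n - y n\<bar>) * M \<le> \<epsilon>'" using dist1 M by (simp add: field_simps)
  have "\<Lambda>' (\<lambda>n. y n * v n) \<le> ulim p b + \<epsilon>'"
  proof -
    have "\<Lambda>' (\<lambda>n. y n * v n) = \<Lambda>' (\<lambda>n. (\<Sum>x\<in>L. f (n + x) * v n) * (1 / real r))"
      by (rule arg_cong[where f = \<Lambda>']) (simp add: fun_eq_iff y_def sum_distrib_right)
    also have "\<dots> = (\<Sum>x\<in>L. b x) * (1 / real r)"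
      unfolding b_def m.sum[OF L(1) bfv, symmetric] by (rule m.cmult_right[OF bdd_sum[OF bfv]])
    also have "\<dots> \<le> (real r * (ulim p b + \<epsilon>')) * (1 / real r)"
    proof (intro mult_right_mono)
      have "(\<Sum>x\<in>L. b x) \<le> real (card L) * (ulim p b + \<epsilon>')"
        by (rule sum_bounded_above) (use L(3) in \<open>auto simp: X_def\<close>)
      then show "(\<Sum>x\<in>L. b x) \<le> real r * (ulim p b + \<epsilon>')" using L(2) by simp
    qed simp
    also have "\<dots> = ulim p b + \<epsilon>'" using r0 by simp
    finally show ?thesis .
  qed
  with wy dist2 wv have "d\<^sup>2 - \<epsilon> \<le> ulim p b" using \<epsilon>'_def by linarith
  moreover have "(\<lambda>N. favg (\<Phi> (q N)) (\<lambda>n. f (n + m) * shiftU p f n)) \<longlonglongrightarrow> b m" for m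
    using q(3)[of m] by (simp add: b_def \<Lambda>'_def folner_mean_def v_def)
  ultimately show thesis using that[OF q(1) p(2) np] by blast
qed

theorem theorem2p7:
  fixes f :: "nat \<Rightarrow> real" and \<Phi> :: "nat \<Rightarrow> nat set" and \<epsilon> :: real
  assumes nonneg: "\<And>n. f n \<ge> 0"
    and bdd: "bounded (range f)"
    and fol: "folner \<Phi>"
    and ex: "corr_exists \<Phi> (\<lambda>_. 1) f"
    and eps: "\<epsilon> > 0"
  shows "\<exists>r p. strict_mono r \<and> is_ultrafilter p \<and> nonprincipal p \<and>
     (\<forall>m. corr_exists (\<Phi> \<circ> r) (shiftR m f) (shiftU p f)) \<and>
     ulim p (\<lambda>m. corr (\<Phi> \<circ> r) (shiftR m f) (shiftU p f))
        \<ge> (corr (\<Phi> \<circ> r) (\<lambda>_. 1) f)\<^sup>2 - \<epsilon>"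
proof -
  have bf: "bdd f" using bdd by (simp add: bdd_def)
  obtain M where M: "0 < M" "\<And>n. \<bar>f n\<bar> \<le> M" using bddE[OF bf] by blast
  have fM: "f n \<le> M" for n using M(2)[of n] by simp
  obtain U where U: "is_ultrafilter U" "U \<le> sequentially"
    using ultrafilter_below[of sequentially] by auto
  \<comment> \<open>Pairs of shifts are coded by one natural number, so that a single subsequence
    makes all correlations converge; passing to it does not change \<open>d\<close>.\<close>
  define h where "h i N = favg (\<Phi> N) (\<lambda>n. f (n + fst (prod_decode i)) * f (n + snd (prod_decode i)))" for i N
  obtain s where s: "strict_mono s" "\<And>i. (\<lambda>k. h i (s k)) \<longlonglongrightarrow> ulim U (h i)"
  proof (rule subsequence_of_ultrafilter[OF U, of UNIV h])
    have "bdd (h i)" for i unfolding h_def[abs_def] using bf by (intro bdd_favg) auto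
    then show "bounded (range (h i))" for i by (simp add: bdd_def)
  qed auto
  have lim_g: "(\<lambda>N. favg ((\<Phi> \<circ> s) N) (\<lambda>n. f (n + l) * f (n + m))) \<longlonglongrightarrow> ulim U (h (prod_encode (l, m)))" for l m
    using s(2)[of "prod_encode (l, m)"] by (simp add: h_def)
  define d where "d = corr \<Phi> (\<lambda>_. 1) f"
  have lim: "(\<lambda>N. favg (\<Phi> N) f) \<longlonglongrightarrow> d"
    using ex unfolding corr_exists_def d_def corr_def convergent_LIMSEQ_iff
    by (simp add: avg_prod_eq_favg[abs_def])
  have lim_s: "(\<lambda>N. favg ((\<Phi> \<circ> s) N) f) \<longlonglongrightarrow> d"
    using LIMSEQ_subseq_LIMSEQ[OF lim s(1)] by (simp add: comp_def)
  obtain r p b where r: "strict_mono r" and p: "is_ultrafilter p" "nonprincipal p"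
    and b: "\<And>m. (\<lambda>N. favg ((\<Phi> \<circ> s) (r N)) (\<lambda>n. f (n + m) * shiftU p f n)) \<longlonglongrightarrow> b m"
    and ge: "d\<^sup>2 - \<epsilon> \<le> ulim p b"
    using recurrence_along_convergent_folner[OF nonneg fM M(1) folner_subseq[OF fol s(1)] lim_s lim_g eps] by blast
  have sr: "strict_mono (s \<circ> r)" using s(1) r by (rule strict_mono_o)
  have b': "avg_prod (\<Phi> \<circ> (s \<circ> r)) (shiftR m f) (shiftU p f) \<longlonglongrightarrow> b m" for m
    using b[of m] by (simp add: avg_prod_eq_favg[abs_def] shiftR_def)
  have "avg_prod (\<Phi> \<circ> (s \<circ> r)) (\<lambda>_. 1) f \<longlonglongrightarrow> d"
    using LIMSEQ_subseq_LIMSEQ[OF lim sr] by (simp add: avg_prod_eq_favg[abs_def] comp_def)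
  then have "corr (\<Phi> \<circ> (s \<circ> r)) (\<lambda>_. 1) f = d" unfolding corr_def by (rule limI)
  moreover have "corr (\<Phi> \<circ> (s \<circ> r)) (shiftR m f) (shiftU p f) = b m" for m
    unfolding corr_def by (rule limI[OF b'])
  moreover have "corr_exists (\<Phi> \<circ> (s \<circ> r)) (shiftR m f) (shiftU p f)" for m
    unfolding corr_exists_def using b' by (rule convergentI)
  ultimately show ?thesis using sr p ge by (intro exI[of _ "s \<circ> r"] exI[of _ p]) simp
qed

end
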